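(* Let $\mathbf d\in\{\mathbb W_p,\mathbb W_p^{\rm ad}\}$ and let $\mu\in\mathcal P_p(\mathbb R^2)$ satisfy condition $\mathbf B_{\mathbf d}$. Let $\Theta=(\Theta_1,\Theta_2):\mathbb R^2\to\mathbb R^2$ be a compactly supported $C^2$ function, with $\Theta_1=0$ if $\mathbf d=\mathbb W_p^{\rm ad}$. Assume further that $\mathrm{supp}(\Theta)\subset M_1\times M_2$ for some $M_1\subsetneq I_1$ and $M_2\subsetneq I_2$. Then there exists $C>0$ such that $$\limsup_{r\to0}\frac1r\,\mathbf d\big(\mu^{r\Theta},\Pi(\mu_1,\mu_2)\big)\le C\Big(\|\mathbb E^\mu_1[\Theta_1]\|_{\mathbb L^p(\mu_1)}+\|\mathbb E^\mu_2[\Theta_2]\|_{\mathbb L^p(\mu_2)}\Big).$$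
   Context: $p>1$; $\mathbb R^2=\mathbb R\times\mathbb R$ with Euclidean norm, points $x=(x_1,x_2)$. $\mathcal P_p(\mathbb R^2)$: probability measures with finite $p$-th moment. $X=(X_1,X_2)$ is the canonical variable, $(X,X')$ the coordinate projections on $\mathbb R^2\times\mathbb R^2$. $\mu_i=\mu\circ X_i^{-1}$; $\mathbb E_i^\mu[\cdot]=\mathbb E^\mu[\cdot|X_i]$. $\mu^{T}=\mu\circ(X+T(X))^{-1}$. $\Pi(\mu_1,\mu_2)$ is the set of probability measures on $\mathbb R^2$ with marginals $\mu_1,\mu_2$. Distances: $\mathbb W_p(\mu,\mu')=\inf_\pi\mathbb E^\pi[|X-X'|^p]^{1/p}$ over couplings $\pi$ of $\mu,\mu'$. A probability $\pi$ on $\mathbb R^2\times\mathbb R^2$ is causal if for all bounded Borel $f:\mathbb R^2\to\mathbb R$, $g:\mathbb R\to\mathbb R$, $\mathbb E^\pi[f(X_1,X_2)g(X_1')|X_1]=\mathbb E^\pi[f(X_1,X_2)|X_1]\mathbb E^\pi[g(X_1')|X_1]$; $\pi$ is bi-causal if $\pi$ and $\pi\circ(X',X)^{-1}$ are causal; $\mathbb W_p^{\rm ad}$ is defined as $\mathbb W_p$ with the infimum restricted to bi-causal couplings. For a set $U$ of measures, $\mathbf d(\nu,U)=\inf_{u\in U}\mathbf d(\nu,u)$. Condition $\mathbf B_{\mathbb W_p}$: $\mu$ admits a density $q$, and for $i=1,2$, $\mu_i(dx)=q_i(x)\mathbf 1_{\{x\in I_i\}}dx$ where $I_i$ is an interval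 and $q_i\in C(I_i,\mathbb R_+)$; moreover $\mu$ admits the disintegration $\mu=k(x_1,x_2)\,dx_2\,\mu_1(dx_1)$ with $k$ bounded. Condition $\mathbf B_{\mathbb W_p^{\rm ad}}$: $\mu(dx)=\kappa(x)\,dx_2\,\mu_1(dx_1)$ with $\kappa$ bounded, and $\mu_2$ is supported in an interval $I_2$, where its density $q_2(x_2)=\frac{d\mu_2}{dx_2}(x_2)=\int\kappa(x)\mu_1(dx_1)$ is continuous. In this case $I_1:=\mathrm{supp}(\mu_1)$. *)

theory Defs
  imports "HOL-Probability.Probability"
begin

text \<open>
  The plane is the product type, whose norm is the Euclidean one, and the coordinates
  \<open>X\<^sub>1\<close>, \<open>X\<^sub>2\<close> are \<^const>\<open>fst\<close> and \<^const>\<open>snd\<close>. Probability measures live on the full Borel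
  \<open>\<sigma>\<close>-algebra. Distances and norms take values in \<^typ>\<open>ennreal\<close>, so that an infinite cost is
  not confused with a zero Bochner integral.
\<close>

definition ennreal_powr :: "ennreal \<Rightarrow> real \<Rightarrow> ennreal" where
  "ennreal_powr x a = (if x = \<infinity> then \<infinity> else ennreal (enn2real x powr a))"

definition lp_norm :: "real \<Rightarrow> 'a measure \<Rightarrow> ('a \<Rightarrow> real) \<Rightarrow> ennreal" where
  "lp_norm p M h = ennreal_powr (\<integral>\<^sup>+x. ennreal (\<bar>h x\<bar> powr p) \<partial>M) (1 / p)"

definition borel_prob :: "'a::topological_space measure \<Rightarrow> bool" where
  "borel_prob \<mu> \<longleftrightarrow> prob_space \<mu> \<and> sets \<mu> = sets borel"

definition prob_moment :: "real \<Rightarrow> 'a::real_normed_vector measure set" where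
  "prob_moment p = {\<mu>. borel_prob \<mu> \<and> (\<integral>\<^sup>+x. ennreal (norm x powr p) \<partial>\<mu>) < \<infinity>}"

definition marg1 :: "(real \<times> real) measure \<Rightarrow> real measure" where
  "marg1 \<mu> = distr \<mu> borel fst"

definition marg2 :: "(real \<times> real) measure \<Rightarrow> real measure" where
  "marg2 \<mu> = distr \<mu> borel snd"

definition measure_supp :: "'a::topological_space measure \<Rightarrow> 'a set" where
  "measure_supp \<mu> = {x. \<forall>U. open U \<longrightarrow> x \<in> U \<longrightarrow> emeasure \<mu> U > 0}"

definition fun_supp :: "('a::topological_space \<Rightarrow> 'b::zero) \<Rightarrow> 'a set" where
  "fun_supp f = closure {x. f x \<noteq> 0}"

text \<open>
  With real marginals this is the set \<open>\<Pi>(\<mu>\<^sub>1, \<mu>\<^sub>2)\<close> of measures on the plane; with marginals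
  on the plane it is the set of couplings entering the Wasserstein distances.
\<close>

definition couplings ::
    "'a::topological_space measure \<Rightarrow> 'b::topological_space measure \<Rightarrow> ('a \<times> 'b) measure set" where
  "couplings \<mu> \<nu> = {\<pi>. borel_prob \<pi> \<and> distr \<pi> borel fst = \<mu> \<and> distr \<pi> borel snd = \<nu>}"

definition transport_dist ::
    "real \<Rightarrow> ('a::real_normed_vector \<times> 'a) measure set \<Rightarrow> ennreal" where
  "transport_dist p P =
     (INF \<pi>\<in>P. ennreal_powr (\<integral>\<^sup>+z. ennreal (norm (fst z - snd z) powr p) \<partial>\<pi>) (1 / p))"

definition sigma_of :: "'a measure \<Rightarrow> ('a \<Rightarrow> real) \<Rightarrow> 'a measure" where
  "sigma_of M Y = vimage_algebra (space M) Y borel"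

definition causal :: "((real \<times> real) \<times> (real \<times> real)) measure \<Rightarrow> bool" where
  "causal \<pi> \<longleftrightarrow>
     (\<forall>f \<in> borel_measurable borel. \<forall>g \<in> borel_measurable borel.
        bounded (range f) \<longrightarrow> bounded (range g) \<longrightarrow>
        (let F = sigma_of \<pi> (\<lambda>z. fst (fst z)) in
          AE z in \<pi>. real_cond_exp \<pi> F (\<lambda>z. f (fst z) * g (fst (snd z))) z =
            real_cond_exp \<pi> F (\<lambda>z. f (fst z)) z *
            real_cond_exp \<pi> F (\<lambda>z. g (fst (snd z))) z))"

definition bicausal :: "((real \<times> real) \<times> (real \<times> real)) measure \<Rightarrow> bool" where
  "bicausal \<pi> \<longleftrightarrow> causal \<pi> \<and> causal (distr \<pi> borel (\<lambda>z. (snd z, fst z)))"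

definition Wp :: "real \<Rightarrow> (real \<times> real) measure \<Rightarrow> (real \<times> real) measure \<Rightarrow> ennreal" where
  "Wp p \<mu> \<nu> = transport_dist p (couplings \<mu> \<nu>)"

definition Wad :: "real \<Rightarrow> (real \<times> real) measure \<Rightarrow> (real \<times> real) measure \<Rightarrow> ennreal" where
  "Wad p \<mu> \<nu> = transport_dist p {\<pi> \<in> couplings \<mu> \<nu>. bicausal \<pi>}"

definition dist_to_set :: "('a \<Rightarrow> 'a \<Rightarrow> ennreal) \<Rightarrow> 'a \<Rightarrow> 'a set \<Rightarrow> ennreal" where
  "dist_to_set d \<nu> U = (INF u\<in>U. d \<nu> u)"

definition perturb ::
    "(real \<times> real) measure \<Rightarrow> (real \<times> real \<Rightarrow> real \<times> real) \<Rightarrow> (real \<times> real) measure" where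
  "perturb \<mu> T = distr \<mu> borel (\<lambda>x. x + T x)"

text \<open>
  \<open>\<mu>(dx) = k(x\<^sub>1, x\<^sub>2) dx\<^sub>2 \<mu>\<^sub>1(dx\<^sub>1)\<close> with \<open>k\<close> bounded; that \<open>k(x\<^sub>1, \<cdot>)\<close> is a probability density
  for \<open>\<mu>\<^sub>1\<close>-almost every \<open>x\<^sub>1\<close> follows from the identity of measures.
\<close>

definition bounded_disintegration ::
    "(real \<times> real) measure \<Rightarrow> (real \<times> real \<Rightarrow> real) \<Rightarrow> bool" where
  "bounded_disintegration \<mu> k \<longleftrightarrow>
     k \<in> borel_measurable borel \<and> (\<forall>x. 0 \<le> k x) \<and> bounded (range k) \<and>
     \<mu> = density (marg1 \<mu> \<Otimes>\<^sub>M lborel) (\<lambda>x. ennreal (k x))"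

definition continuous_density_on :: "real measure \<Rightarrow> real set \<Rightarrow> bool" where
  "continuous_density_on m I \<longleftrightarrow>
     is_interval I \<and>
     (\<exists>q. continuous_on I q \<and> (\<forall>x\<in>I. 0 \<le> q x) \<and>
          m = density lborel (\<lambda>x. ennreal (q x) * indicator I x))"

definition condition_Wp :: "(real \<times> real) measure \<Rightarrow> real set \<Rightarrow> real set \<Rightarrow> bool" where
  "condition_Wp \<mu> I1 I2 \<longleftrightarrow>
     (\<exists>q \<in> borel_measurable borel. \<mu> = density lborel q) \<and>
     continuous_density_on (marg1 \<mu>) I1 \<and> continuous_density_on (marg2 \<mu>) I2 \<and>
     (\<exists>k. bounded_disintegration \<mu> k)"

text \<open>
  ``Supported in \<open>I\<^sub>2\<close>'' means concentrated on \<open>I\<^sub>2\<close>, so the interval need not be closed. The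
  integral below is a density of the second marginal by the disintegration.
\<close>

definition condition_Wad :: "(real \<times> real) measure \<Rightarrow> real set \<Rightarrow> real set \<Rightarrow> bool" where
  "condition_Wad \<mu> I1 I2 \<longleftrightarrow>
     I1 = measure_supp (marg1 \<mu>) \<and> is_interval I2 \<and> (AE x in marg2 \<mu>. x \<in> I2) \<and>
     (\<exists>\<kappa>. bounded_disintegration \<mu> \<kappa> \<and>
          continuous_on I2 (\<lambda>x2. \<integral>x1. \<kappa> (x1, x2) \<partial>marg1 \<mu>))"

definition C2 :: "(real \<times> real \<Rightarrow> real \<times> real) \<Rightarrow> bool" where
  "C2 T \<longleftrightarrow>
     (\<exists>(D :: real \<times> real \<Rightarrow> (real \<times> real) \<Rightarrow>\<^sub>L (real \<times> real))
       (D2 :: real \<times> real \<Rightarrow> (real \<times> real) \<Rightarrow>\<^sub>L ((real \<times> real) \<Rightarrow>\<^sub>L (real \<times> real))).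
        (\<forall>x. (T has_derivative blinfun_apply (D x)) (at x)) \<and>
        (\<forall>x. (D has_derivative blinfun_apply (D2 x)) (at x)) \<and>
        continuous_on UNIV D2)"

text \<open>
  \<open>E[f | Y]\<close> as a function of the value of \<open>Y\<close>, i.e. a Borel \<open>h\<close> with \<open>E[f | Y] = h(Y)\<close> almost
  surely. It is determined up to null sets of the law of \<open>Y\<close>; the lemma below shows that such an
  \<open>h\<close> exists when \<open>Y\<close> is a coordinate.
\<close>

definition cond_exp_given :: "'a measure \<Rightarrow> ('a \<Rightarrow> real) \<Rightarrow> ('a \<Rightarrow> real) \<Rightarrow> real \<Rightarrow> real" where
  "cond_exp_given M Y f = (SOME h. h \<in> borel_measurable borel \<and>
     (AE x in M. real_cond_exp M (sigma_of M Y) f x = h (Y x)))"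

lemma cond_exp_given_coordinate:
  fixes \<mu> :: "(real \<times> real) measure"
  assumes \<mu>: "borel_prob \<mu>" and Y: "Y = fst \<or> Y = snd"
  shows "cond_exp_given \<mu> Y f \<in> borel_measurable borel \<and>
    (AE x in \<mu>. real_cond_exp \<mu> (sigma_of \<mu> Y) f x = cond_exp_given \<mu> Y f (Y x))"
proof -
  have sp: "space \<mu> = UNIV" using \<mu> sets_eq_imp_space_eq[of \<mu> borel] by (auto simp: borel_prob_def)
  define s :: "real \<Rightarrow> real \<times> real" where "s = (if Y = fst then (\<lambda>t. (t, 0)) else (\<lambda>t. (0, t)))"
  have Ys: "Y (s t) = t" for t using Y by (auto simp: s_def)
  let ?g = "real_cond_exp \<mu> (sigma_of \<mu> Y) f"
  have sets: "sets (sigma_of \<mu> Y) = {Y -` A |A. A \<in> sets borel}"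
    by (simp add: sigma_of_def sp sets_vimage_algebra2)
  have g: "?g \<in> borel_measurable (sigma_of \<mu> Y)" by simp
  have space: "space (sigma_of \<mu> Y) = UNIV" by (simp add: sigma_of_def sp)
  have eq: "?g x = ?g (s (Y x))" for x
  proof -
    have "?g -` {?g x} \<in> sets (sigma_of \<mu> Y)"
      using measurable_sets[OF g, of "{?g x}"] by (simp add: space)
    then obtain A where A: "?g -` {?g x} = Y -` A" by (auto simp: sets)
    have "x \<in> Y -` A" by (simp flip: A)
    then have "s (Y x) \<in> Y -` A" by (simp add: Ys)
    then show ?thesis by (simp flip: A)
  qed
  have "s \<in> borel \<rightarrow>\<^sub>M sigma_of \<mu> Y"
    unfolding sigma_of_def sp by (rule measurable_vimage_algebra2) (auto simp: Ys)
  then have "(\<lambda>t. ?g (s t)) \<in> borel_measurable borel" by (rule measurable_compose[OF _ g])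
  then have "\<exists>h. h \<in> borel_measurable borel \<and> (AE x in \<mu>. ?g x = h (Y x))"
    using eq by (intro exI[of _ "\<lambda>t. ?g (s t)"]) auto
  then show ?thesis unfolding cond_exp_given_def by (rule someI_ex)
qed

end

theory Submission
  imports Defs
begin

text \<open>
  Let \<open>h\<^sub>i\<close> be the conditional expectation of \<open>\<Theta>\<^sub>i\<close> given \<open>X\<^sub>i\<close>, and \<open>W\<^sub>i = \<Theta>\<^sub>i - h\<^sub>i(X\<^sub>i)\<close>. Moving
  \<open>X\<^sub>i\<close> by \<open>r W\<^sub>i\<close> changes its law only to second order: the distribution function of
  \<open>X\<^sub>i + r W\<^sub>i\<close> differs from that of \<open>X\<^sub>i\<close> by \<open>- r E[W\<^sub>i | X\<^sub>i = t]\<close> times the density at \<open>t\<close>,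
  which is zero, up to an error that is \<open>o(r)\<close> in \<open>L\<^sup>1(dt)\<close>, because translations are continuous
  in \<open>L\<^sup>1\<close>. After adding independent noise of size \<open>r\<^sup>2\<close> to remove atoms, the monotone
  rearrangement restores the law \<open>\<mu>\<^sub>i\<close> at a cost that is \<open>O(r)\<close> uniformly and \<open>o(r)\<close> in mean,
  hence \<open>o(r)\<close> in \<open>L\<^sup>p\<close>. Correcting both coordinates separately gives an element of
  \<open>\<Pi>(\<mu>\<^sub>1, \<mu>\<^sub>2)\<close> at distance at most \<open>O(r) (\<parallel>h\<^sub>1\<parallel> + \<parallel>h\<^sub>2\<parallel>) + o(r)\<close> from the perturbed measure.
  If \<open>\<Theta>\<^sub>1 = 0\<close>, the first coordinate is left alone, and a coupling under which the first
  coordinates agree is bi-causal.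
\<close>

text \<open>Transport on the line has a cost linear in the difference of the laws only for exponent
  1, where it is the L^1 distance of the distribution functions. The first-order analysis is done in
  that norm, and p > 1 is reached by interpolation: an error E between 0 and r K with mean o(r)
  satisfies E^p \<le> (r K)^(p-1) E.

  The obstacle is that W_i also depends on the other coordinate, so the shift is not determined by
  X_i. It is therefore replaced by a function with finitely many values: on each of its level events
  X_i is merely translated, and its law restricted to the event still has a density. The first-order
  terms of the pieces add up to a conditional mean that is nearly zero.

  The rearrangement is a map applied to the perturbed coordinate itself. Hence the perturbed point
  and both corrected coordinates live on one probability space, and their joint law supplies at once
  the element of \<Pi> and the plan leading to it. The noise has size r^2 so that its cost vanishes
  after division by r. The final constant is 4, from bounding a sum of four terms by four times the
  largest.\<close>

subsection \<open>Monotone rearrangement on the line\<close>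

lemma nn_integral_abs_diff_indicator_atMost:
  fixes a b :: real
  shows "(\<integral>\<^sup>+t. ennreal \<bar>indicator {a..} t - indicator {b..} t\<bar> \<partial>lborel) = ennreal \<bar>a - b\<bar>"
proof -
  have "(\<integral>\<^sup>+t. ennreal \<bar>indicator {a..} t - indicator {b..} t\<bar> \<partial>lborel)
      = (\<integral>\<^sup>+t. indicator {min a b..<max a b} t \<partial>lborel)"
    by (intro nn_integral_cong) (auto simp: indicator_def min_def max_def)
  then show ?thesis by (auto simp: min_def max_def)
qed

text \<open>Exactly one of the two step functions is 1 between \<open>a \<omega>\<close> and
  \<open>b \<omega>\<close>, and Tonelli swaps the integrals. For fixed \<open>t\<close> the inner
  integral is the probability that exactly one of \<open>a\<close>, \<open>b\<close> is at most
  \<open>t\<close>; it becomes a difference of distribution functions as soon as these two events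
  are nested.\<close>

lemma (in prob_space) nn_integral_abs_diff_cdf:
  fixes a b :: "'a \<Rightarrow> real"
  assumes [measurable]: "random_variable borel a" "random_variable borel b"
  shows "(\<integral>\<^sup>+\<omega>. ennreal \<bar>a \<omega> - b \<omega>\<bar> \<partial>M) =
    (\<integral>\<^sup>+t. (\<integral>\<^sup>+\<omega>. ennreal \<bar>indicator {a \<omega>..} t - indicator {b \<omega>..} t\<bar> \<partial>M) \<partial>lborel)"
proof -
  interpret pair_sigma_finite M "lborel :: real measure" ..
  have [measurable]: "(\<lambda>(\<omega>, t). ennreal \<bar>indicator {a \<omega>..} t - indicator {b \<omega>..} t\<bar>)
      \<in> borel_measurable (M \<Otimes>\<^sub>M lborel)"
    by (simp add: indicator_def)
  show ?thesis
    by (subst Fubini') (simp_all add: nn_integral_abs_diff_indicator_atMost)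
qed

text \<open>The easy half of the cost formula: moving the absolute value outside the inner integral
  only allows cancellation. It pays for exchanging a perturbation for a nearby one, when
  \<open>W\<close> is made discrete and when the noise is added.\<close>

lemma (in prob_space) nn_integral_cdf_diff_le:
  fixes a b :: "'a \<Rightarrow> real"
  assumes [measurable]: "random_variable borel a" "random_variable borel b"
  shows "(\<integral>\<^sup>+t. ennreal \<bar>prob {\<omega>\<in>space M. a \<omega> \<le> t} - prob {\<omega>\<in>space M. b \<omega> \<le> t}\<bar> \<partial>lborel)
    \<le> (\<integral>\<^sup>+\<omega>. ennreal \<bar>a \<omega> - b \<omega>\<bar> \<partial>M)"
  unfolding nn_integral_abs_diff_cdf[OF assms]
proof (rule nn_integral_mono)
  fix t
  have i: "integrable M (\<lambda>\<omega>. indicator {a \<omega>..} t :: real)" "integrable M (\<lambda>\<omega>. indicator {b \<omega>..} t :: real)"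
    by (auto intro!: integrable_const_bound[of _ 1] simp: indicator_def)
  have "prob {\<omega>\<in>space M. c \<omega> \<le> t} = (\<integral>\<omega>. indicator {c \<omega>..} t \<partial>M)"
    if [measurable]: "random_variable borel c" for c :: "'a \<Rightarrow> real"
  proof -
    have "(\<integral>\<omega>. indicator {c \<omega>..} t \<partial>M) = (\<integral>\<omega>. indicator {\<omega>\<in>space M. c \<omega> \<le> t} \<omega> \<partial>M)"
      by (intro Bochner_Integration.integral_cong) (auto simp: indicator_def)
    also have "\<dots> = prob {\<omega>\<in>space M. c \<omega> \<le> t}"
      by (subst Bochner_Integration.integral_indicator) (auto intro!: arg_cong[where f=prob])
    finally show ?thesis by simp
  qed
  then have "\<bar>prob {\<omega>\<in>space M. a \<omega> \<le> t} - prob {\<omega>\<in>space M. b \<omega> \<le> t}\<bar>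
      = \<bar>\<integral>\<omega>. indicator {a \<omega>..} t - indicator {b \<omega>..} t \<partial>M\<bar>"
    using i by simp
  also have "ennreal \<dots> \<le> (\<integral>\<^sup>+\<omega>. ennreal \<bar>indicator {a \<omega>..} t - indicator {b \<omega>..} t\<bar> \<partial>M)"
    using integral_norm_bound_ennreal[OF Bochner_Integration.integrable_diff[OF i]] by simp
  finally show "ennreal \<bar>prob {\<omega>\<in>space M. a \<omega> \<le> t} - prob {\<omega>\<in>space M. b \<omega> \<le> t}\<bar> \<le> \<dots>" .
qed

lemma (in prob_space) cdf_distr_eq:
  assumes [measurable]: "random_variable borel X"
  shows "cdf (distr M borel X) t = prob {\<omega>\<in>space M. X \<omega> \<le> t}"
  by (auto simp: cdf_def measure_distr intro!: arg_cong[where f=prob])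

lemma (in prob_space) prob_cdf_le:
  fixes Y :: "'a \<Rightarrow> real"
  assumes [measurable]: "random_variable borel Y"
    and atomless: "\<And>t. prob {\<omega>\<in>space M. Y \<omega> = t} = 0"
    and u: "0 \<le> u" "u \<le> 1"
  shows "prob {\<omega>\<in>space M. cdf (distr M borel Y) (Y \<omega>) \<le> u} = u"
proof -
  interpret D: cdf_distribution "distr M borel Y" unfolding cdf_distribution_def by (rule real_distribution_distr) measurable
  let ?F = "cdf (distr M borel Y)"
  have cont: "isCont ?F x" for x
    unfolding D.isCont_cdf using atomless[of x]
    by (simp add: measure_distr vimage_def Int_def conj_commute)
  have eq: "prob {\<omega>\<in>space M. ?F (Y \<omega>) \<le> v} = v" if v: "0 < v" "v < 1" for v
  proof -
    define S where "S = {y. ?F y \<le> v}"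
    obtain a where a: "?F a < v"
      using order_tendstoD(2)[OF D.bot v(1)] by (auto dest!: eventually_happens'[rotated])
    obtain b where b: "?F b > v"
      using order_tendstoD(1)[OF D.top v(2)] by (auto dest!: eventually_happens'[rotated])
    have bb: "y \<le> b" if "y \<in> S" for y
      using that b D.mono[THEN monoD, of b y] by (fastforce simp: S_def)
    have cl: "closed S" unfolding S_def
      by (intro closed_Collect_le continuous_intros continuous_at_imp_continuous_on) (use cont in auto)
    have bdd: "bdd_above S" using bb by (auto simp: bdd_above_def)
    have ne: "S \<noteq> {}" using a by (auto simp: S_def intro: less_imp_le)
    define m where "m = Sup S"
    have mS: "m \<in> S" unfolding m_def by (rule closed_contains_Sup[OF ne bdd cl])
    have "?F m \<le> v" using mS by (simp add: S_def)
    \<comment> \<open>By continuity, a value below \<open>v\<close> at \<open>m\<close> would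
      persist slightly to the right, against the choice of \<open>m\<close> as supremum.\<close>
    moreover have "\<not> ?F m < v"
    proof
      assume "?F m < v"
      then have "\<forall>\<^sub>F y in at m. ?F y < v" using cont[of m] order_tendstoD(2) isContD by blast
      then have "\<forall>\<^sub>F y in at_right m. ?F y < v" by (simp add: eventually_at_split)
      from eventually_happens'[OF trivial_limit_at_right_real eventually_conj[OF eventually_at_right_less this]]
      obtain y where "?F y < v" "y > m" by blast
      then show False using cSup_upper[OF _ bdd, of y] by (auto simp: S_def m_def)
    qed
    ultimately have Fm: "?F m = v" by simp
    have "?F y \<le> v \<longleftrightarrow> y \<le> m" for y
      using cSup_upper[OF _ bdd, of y] Fm D.mono[THEN monoD, of y m] by (auto simp: S_def m_def)
    then show ?thesis using Fm by (simp add: cdf_distr_eq)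
  qed
  consider "u = 0" | "u = 1" | "0 < u" "u < 1" using u by linarith
  then show ?thesis
  proof cases
    case 1
    \<comment> \<open>At level 0 the sublevel set may be empty and have no supremum. The case is
      squeezed below small positive levels, and \<open>1/2\<close> keeps these inside the open unit
      interval.\<close>
    have "prob {\<omega>\<in>space M. ?F (Y \<omega>) \<le> 0} \<le> e" if "e > 0" for e :: real
    proof -
      have "prob {\<omega>\<in>space M. ?F (Y \<omega>) \<le> 0} \<le> prob {\<omega>\<in>space M. ?F (Y \<omega>) \<le> min e (1/2)}"
        using that by (intro finite_measure_mono) auto
      also have "\<dots> \<le> e" using that by (subst eq) auto
      finally show ?thesis .
    qed
    then have "prob {\<omega>\<in>space M. ?F (Y \<omega>) \<le> 0} \<le> 0" by (rule field_le_epsilon[of _ 0, simplified])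
    then show ?thesis using 1 measure_nonneg[of M] by (simp add: antisym)
  next
    case 2
    then show ?thesis using D.cdf_bounded_prob by (simp add: prob_space)
  qed (use eq in auto)
qed

text \<open>The map is \<open>T = F\<^sub>X\<^sup>-\<^sup>1 \<circ> F\<^sub>Y\<close>.\<close>

lemma (in prob_space) monotone_rearrangement:
  fixes X Y :: "'a \<Rightarrow> real"
  assumes [measurable]: "random_variable borel X" "random_variable borel Y"
    and atomless: "\<And>t. prob {\<omega>\<in>space M. Y \<omega> = t} = 0"
  obtains T where "T \<in> borel_measurable borel"
    "distr M borel (\<lambda>\<omega>. T (Y \<omega>)) = distr M borel X"
    "(\<integral>\<^sup>+\<omega>. ennreal \<bar>T (Y \<omega>) - Y \<omega>\<bar> \<partial>M) =
      (\<integral>\<^sup>+t. ennreal \<bar>prob {\<omega>\<in>space M. Y \<omega> \<le> t} - prob {\<omega>\<in>space M. X \<omega> \<le> t}\<bar> \<partial>lborel)"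
    "\<And>c. (AE \<omega> in M. \<bar>X \<omega> - Y \<omega>\<bar> \<le> c) \<Longrightarrow> AE \<omega> in M. \<bar>T (Y \<omega>) - Y \<omega>\<bar> \<le> c"
proof
  let ?F = "cdf (distr M borel Y)" and ?G = "cdf (distr M borel X)"
  interpret Y: cdf_distribution "distr M borel Y" unfolding cdf_distribution_def by (rule real_distribution_distr) measurable
  interpret X: cdf_distribution "distr M borel X" unfolding cdf_distribution_def by (rule real_distribution_distr) measurable
  \<comment> \<open>The quantile function \<open>X.I\<close> is meaningful only on the open unit
    interval. The value 0 elsewhere is a default, met with probability 0 by
    \<open>F0\<close>.\<close>
  define T where "T y = (if ?F y \<in> {0<..<1} then X.I (?F y) else 0)" for y
  have I: "(\<lambda>u. if u \<in> {0<..<1} then X.I u else 0) \<in> borel_measurable borel"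
    using X.measurable_CI by (subst measurable_If_restrict_space_iff) (auto simp: greaterThanLessThan_def greaterThan_def lessThan_def Int_def)
  show T[measurable]: "T \<in> borel_measurable borel"
    unfolding T_def by (rule measurable_compose[OF Y.measurable_C I])
  note U = prob_cdf_le[OF assms(2) atomless]
  have F0: "AE \<omega> in M. ?F (Y \<omega>) \<in> {0<..<1}"
  proof -
    have "prob {\<omega>\<in>space M. ?F (Y \<omega>) \<le> 0} = 0" using U[of 0] by simp
    then have 1: "AE \<omega> in M. \<not> ?F (Y \<omega>) \<le> 0" by (subst AE_iff_measurable[OF _ refl]) (auto simp: emeasure_eq_measure)
    have "prob {\<omega>\<in>space M. \<not> ?F (Y \<omega>) < 1} \<le> e" if "0 < e" for e
    proof -
      have "prob {\<omega>\<in>space M. \<not> ?F (Y \<omega>) < 1} \<le> prob (space M - {\<omega>\<in>space M. ?F (Y \<omega>) \<le> 1 - min e 1})"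
        using that by (intro finite_measure_mono) auto
      also have "\<dots> = min e 1" using that by (subst prob_compl) (auto simp: U)
      finally show ?thesis by simp
    qed
    then have "prob {\<omega>\<in>space M. \<not> ?F (Y \<omega>) < 1} \<le> 0" by (rule field_le_epsilon[of _ 0, simplified])
    then have "prob {\<omega>\<in>space M. \<not> ?F (Y \<omega>) < 1} = 0" using measure_nonneg[of M] by (simp add: antisym)
    then have 2: "AE \<omega> in M. ?F (Y \<omega>) < 1" by (subst AE_iff_measurable[OF _ refl]) (auto simp: emeasure_eq_measure)
    from 1 2 show ?thesis by eventually_elim auto
  qed
  have TG: "T y \<le> t \<longleftrightarrow> ?F y \<le> ?G t" if "?F y \<in> {0<..<1}" for y t
    using X.pseudoinverse[of "?F y" t] that by (simp add: T_def)
  have AT: "AE \<omega> in M. T (Y \<omega>) \<le> t \<longleftrightarrow> ?F (Y \<omega>) \<le> ?G t" for t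
    using F0 by eventually_elim (rule TG)
  \<comment> \<open>The converse of monotonicity can fail on a flat piece of \<open>?F\<close> to
    the right of \<open>t\<close>, but both events have probability \<open>?F t\<close>, so the
    exception is null.\<close>
  have AY: "AE \<omega> in M. Y \<omega> \<le> t \<longleftrightarrow> ?F (Y \<omega>) \<le> ?F t" for t
  proof -
    let ?A = "{\<omega>\<in>space M. Y \<omega> \<le> t}" and ?B = "{\<omega>\<in>space M. ?F (Y \<omega>) \<le> ?F t}"
    have sub: "?A \<subseteq> ?B" using Y.mono[THEN monoD] by auto
    have "prob (?B - ?A) = prob ?B - prob ?A" using sub by (intro finite_measure_Diff) auto
    also have "\<dots> = 0" by (simp add: U Y.cdf_nonneg Y.cdf_bounded_prob cdf_distr_eq[symmetric])
    finally have "AE \<omega> in M. \<not> (?F (Y \<omega>) \<le> ?F t \<and> \<not> Y \<omega> \<le> t)"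
      by (subst AE_iff_measurable[OF _ refl]) (auto simp: emeasure_eq_measure set_diff_eq cong: conj_cong intro!: arg_cong[where f=prob])
    then show ?thesis
    proof eventually_elim
      case (elim \<omega>)
      then show ?case using Y.mono[THEN monoD, of "Y \<omega>" t] by auto
    qed
  qed
  show "distr M borel (\<lambda>\<omega>. T (Y \<omega>)) = distr M borel X"
  proof (rule cdf_unique)
    show "cdf (distr M borel (\<lambda>\<omega>. T (Y \<omega>))) = ?G"
    proof
      fix t
      have "cdf (distr M borel (\<lambda>\<omega>. T (Y \<omega>))) t = prob {\<omega>\<in>space M. T (Y \<omega>) \<le> t}"
        by (rule cdf_distr_eq) measurable
      also have "\<dots> = prob {\<omega>\<in>space M. ?F (Y \<omega>) \<le> ?G t}"
        using AT[of t] by (intro measure_eq_AE) auto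
      also have "\<dots> = ?G t" by (simp add: U X.cdf_nonneg X.cdf_bounded_prob)
      finally show "cdf (distr M borel (\<lambda>\<omega>. T (Y \<omega>))) t = ?G t" .
    qed
  qed auto
  show "(\<integral>\<^sup>+\<omega>. ennreal \<bar>T (Y \<omega>) - Y \<omega>\<bar> \<partial>M) =
      (\<integral>\<^sup>+t. ennreal \<bar>prob {\<omega>\<in>space M. Y \<omega> \<le> t} - prob {\<omega>\<in>space M. X \<omega> \<le> t}\<bar> \<partial>lborel)"
  proof -
    \<comment> \<open>Up to null sets, \<open>T (Y \<omega>) \<le> t\<close> and
      \<open>Y \<omega> \<le> t\<close> are sublevel events of the same uniform variable
      \<open>?F (Y \<omega>)\<close>, at the levels \<open>?G t\<close> and \<open>?F t\<close>.
      They are nested, so the event where exactly one occurs has probability equal to the difference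
      of the levels. This turns the cost inequality into an equality.\<close>
    have "(\<integral>\<^sup>+\<omega>. ennreal \<bar>indicator {T (Y \<omega>)..} t - indicator {Y \<omega>..} t\<bar> \<partial>M) = ennreal \<bar>?F t - ?G t\<bar>" for t
    proof -
      define hi lo where "hi = max (?F t) (?G t)" and "lo = min (?F t) (?G t)"
      have hl: "0 \<le> lo" "lo \<le> hi" "hi \<le> 1"
        by (auto simp: hi_def lo_def X.cdf_nonneg Y.cdf_nonneg X.cdf_bounded_prob Y.cdf_bounded_prob)
      let ?D = "{\<omega>\<in>space M. ?F (Y \<omega>) \<le> hi} - {\<omega>\<in>space M. ?F (Y \<omega>) \<le> lo}"
      have "(\<integral>\<^sup>+\<omega>. ennreal \<bar>indicator {T (Y \<omega>)..} t - indicator {Y \<omega>..} t\<bar> \<partial>M) = (\<integral>\<^sup>+\<omega>. indicator ?D \<omega> \<partial>M)"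
      proof (rule nn_integral_cong_AE)
        show "AE \<omega> in M. ennreal \<bar>indicator {T (Y \<omega>)..} t - indicator {Y \<omega>..} t\<bar> = indicator ?D \<omega>"
          using AE_space AT[of t] AY[of t]
        proof eventually_elim
          case (elim \<omega>)
          then show ?case by (cases "?F t \<le> ?G t") (simp_all add: indicator_def hi_def lo_def min_def max_def)
        qed
      qed
      also have "\<dots> = emeasure M ?D" by simp
      also have "\<dots> = ennreal (hi - lo)"
        using hl by (subst emeasure_eq_measure, subst finite_measure_Diff) (auto simp: U)
      also have "hi - lo = \<bar>?F t - ?G t\<bar>" by (auto simp: hi_def lo_def)
      finally show ?thesis .
    qed
    then show ?thesis by (subst nn_integral_abs_diff_cdf) (simp_all add: cdf_distr_eq)
  qed
  fix c assume c: "AE \<omega> in M. \<bar>X \<omega> - Y \<omega>\<bar> \<le> c"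
  \<comment> \<open>An almost sure distance of at most \<open>c\<close> compares the distribution
    functions up to shifts by \<open>c\<close>, and this comparison passes to the quantile function,
    hence to \<open>T\<close>.\<close>
  have GF: "?G (t - c) \<le> ?F t" "?F t \<le> ?G (t + c)" for t
    using c by (auto simp: cdf_distr_eq intro!: finite_measure_mono_AE)
  \<comment> \<open>The threshold used below depends on \<open>\<omega>\<close>, so one null set
    must serve all thresholds, and only countably many can be united. Rational ones suffice, since
    one fits strictly between \<open>T (Y \<omega>) + c\<close> and
    \<open>Y \<omega>\<close>.\<close>
  have "AE \<omega> in M. \<forall>t\<in>\<rat>. Y \<omega> \<le> t \<longleftrightarrow> ?F (Y \<omega>) \<le> ?F t"
    using AY by (subst AE_ball_countable) (auto simp: countable_rat)
  with F0 show "AE \<omega> in M. \<bar>T (Y \<omega>) - Y \<omega>\<bar> \<le> c"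
  proof eventually_elim
    case (elim \<omega>)
    have "T (Y \<omega>) \<le> Y \<omega> + c" using GF(2)[of "Y \<omega>"] TG[OF elim(1)] by simp
    moreover have "Y \<omega> - c \<le> T (Y \<omega>)"
    proof (rule ccontr)
      assume "\<not> Y \<omega> - c \<le> T (Y \<omega>)"
      then obtain t where t: "t \<in> \<rat>" "T (Y \<omega>) + c < t" "t < Y \<omega>"
        using Rats_dense_in_real[of "T (Y \<omega>) + c" "Y \<omega>"] by auto
      have "?F (Y \<omega>) \<le> ?G (T (Y \<omega>))" using TG[OF elim(1)] by blast
      also have "\<dots> \<le> ?G (t - c)" using t by (intro X.mono[THEN monoD]) auto
      also have "\<dots> \<le> ?F t" by (rule GF)
      finally show False using elim(2) t by auto
    qed
    ultimately show ?case by auto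
  qed
qed

subsection \<open>Continuity of translations in \<open>L\<^sup>1\<close>\<close>

lemma nn_integral_abs_add_le:
  fixes f g :: "'a \<Rightarrow> real"
  assumes [measurable]: "f \<in> borel_measurable M" "g \<in> borel_measurable M"
  shows "(\<integral>\<^sup>+x. ennreal \<bar>f x + g x\<bar> \<partial>M) \<le> (\<integral>\<^sup>+x. ennreal \<bar>f x\<bar> \<partial>M) + (\<integral>\<^sup>+x. ennreal \<bar>g x\<bar> \<partial>M)"
proof -
  have "(\<integral>\<^sup>+x. ennreal \<bar>f x + g x\<bar> \<partial>M) \<le> (\<integral>\<^sup>+x. ennreal \<bar>f x\<bar> + ennreal \<bar>g x\<bar> \<partial>M)"
    by (intro nn_integral_mono) (simp flip: ennreal_plus add: ennreal_leI)
  then show ?thesis by (simp add: nn_integral_add)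
qed

text \<open>The translated indicators need not converge on the boundary of \<open>U\<close>. Their
  products with the indicator of \<open>U\<close> do converge everywhere, because a point of an open
  set stays in it under small shifts. As translation preserves measure, the symmetric difference has
  twice the measure that the overlap lacks.\<close>

lemma L1_translation_tendsto_open:
  fixes v :: "nat \<Rightarrow> real" and U :: "real set"
  assumes v: "v \<longlonglongrightarrow> 0" and U: "open U" "emeasure lborel U < \<infinity>"
  shows "(\<lambda>n. \<integral>\<^sup>+t. ennreal \<bar>indicator U (t + v n) - indicator U t\<bar> \<partial>lborel) \<longlonglongrightarrow> 0"
proof -
  have [measurable]: "U \<in> sets borel" using U by auto
  let ?W = "\<lambda>n. (\<lambda>t. t + v n) -` U"
  have W [measurable]: "?W n \<in> sets borel" for n
    using measurable_sets_borel[of "\<lambda>t. t + v n" borel U] by simp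
  have UW: "emeasure lborel (?W n) = emeasure lborel U" for n
  proof -
    have "emeasure lborel U = emeasure (distr lborel borel ((+) (v n))) U" by (subst lborel_distr_plus) simp
    also have "\<dots> = emeasure lborel (?W n)" by (subst emeasure_distr) (auto simp: add.commute vimage_def)
    finally show ?thesis ..
  qed
  have fU: "U \<in> fmeasurable lborel" "?W n \<in> fmeasurable lborel" for n
    using U UW by (auto simp: fmeasurable_def)
  have lim: "(\<lambda>n. measure lborel (U \<inter> ?W n)) \<longlonglongrightarrow> measure lborel U"
  proof -
    have "(\<lambda>n. \<integral>t. indicator (U \<inter> ?W n) t \<partial>lborel) \<longlonglongrightarrow> (\<integral>t. (indicator U t :: real) \<partial>lborel)"
    proof (rule integral_dominated_convergence[where w="indicator U"])
      show "integrable lborel (indicator U :: real \<Rightarrow> real)" using U by simp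
      show "AE t in lborel. (\<lambda>n. indicator (U \<inter> ?W n) t) \<longlonglongrightarrow> (indicator U t :: real)"
      proof (rule AE_I2)
        fix t
        show "(\<lambda>n. indicator (U \<inter> ?W n) t) \<longlonglongrightarrow> (indicator U t :: real)"
        proof (cases "t \<in> U")
          case True
          have "(\<lambda>n. t + v n) \<longlonglongrightarrow> t" using tendsto_add[OF tendsto_const v, of t] by simp
          then have "\<forall>\<^sub>F n in sequentially. t + v n \<in> U" using U(1) True by (rule topological_tendstoD)
          then show ?thesis using True
            by (intro tendsto_eventually) (auto elim!: eventually_mono)
        qed simp
      qed
    qed (auto simp: indicator_def)
    then show ?thesis by simp
  qed
  have eq: "(\<integral>\<^sup>+t. ennreal \<bar>indicator U (t + v n) - indicator U t\<bar> \<partial>lborel) =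
      ennreal (2 * (measure lborel U - measure lborel (U \<inter> ?W n)))" for n
  proof -
    have "(\<integral>\<^sup>+t. ennreal \<bar>indicator U (t + v n) - indicator U t\<bar> \<partial>lborel) =
        (\<integral>\<^sup>+t. indicator (U - U \<inter> ?W n) t + indicator (?W n - U \<inter> ?W n) t \<partial>lborel)"
      by (intro nn_integral_cong) (auto simp: indicator_def)
    also have "\<dots> = emeasure lborel (U - U \<inter> ?W n) + emeasure lborel (?W n - U \<inter> ?W n)"
      by (subst nn_integral_add) auto
    also have "\<dots> = ennreal (measure lborel (U - U \<inter> ?W n)) + ennreal (measure lborel (?W n - U \<inter> ?W n))"
      using fU by (auto intro!: arg_cong2[where f="(+)"] emeasure_eq_measure2 fmeasurable.Diff fmeasurable_Int_fmeasurable)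
    also have "measure lborel (?W n - U \<inter> ?W n) = measure lborel (U - U \<inter> ?W n)"
      using fU UW by (subst (1 2) measurable_measure_Diff) (auto simp: measure_def intro!: fmeasurable_Int_fmeasurable)
    also have "ennreal (measure lborel (U - U \<inter> ?W n)) + ennreal (measure lborel (U - U \<inter> ?W n)) =
        ennreal (2 * measure lborel (U - U \<inter> ?W n))" by (simp flip: ennreal_plus)
    also have "measure lborel (U - U \<inter> ?W n) = measure lborel U - measure lborel (U \<inter> ?W n)"
      using fU by (subst measurable_measure_Diff) (auto intro!: fmeasurable_Int_fmeasurable)
    finally show ?thesis .
  qed
  show ?thesis unfolding eq ennreal_0[symmetric]
    by (intro tendsto_ennrealI) (auto intro!: tendsto_eq_intros lim)
qed

lemma ennreal_tendsto_0_approx: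
  fixes a :: "nat \<Rightarrow> ennreal"
  assumes "\<And>e::real. e > 0 \<Longrightarrow> \<exists>b. b \<longlonglongrightarrow> 0 \<and> (\<forall>n. a n \<le> b n + ennreal e)"
  shows "a \<longlonglongrightarrow> 0"
proof (rule order_tendstoI)
  fix c :: ennreal assume "0 < c"
  then obtain e :: real where e: "0 < e" "ennreal (2 * e) < c"
  proof (cases c)
    case (real r)
    then show ?thesis using that[of "r / 4"] \<open>0 < c\<close> by (auto simp: ennreal_less_iff)
  next
    case top
    then show ?thesis using that[of 1] by simp
  qed
  obtain b where b: "b \<longlonglongrightarrow> 0" "\<And>n. a n \<le> b n + ennreal e" using assms[OF e(1)] by blast
  have "\<forall>\<^sub>F n in sequentially. b n < ennreal e" using order_tendstoD(2)[OF b(1), of "ennreal e"] e by simp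
  then show "\<forall>\<^sub>F n in sequentially. a n < c"
  proof eventually_elim
    case (elim n)
    have "a n \<le> ennreal e + ennreal e" using b(2)[of n] elim by (meson add_right_mono less_imp_le order_trans)
    also have "\<dots> = ennreal (2 * e)" using e by (simp flip: ennreal_plus)
    finally show ?case using e(2) by (rule le_less_trans)
  qed
qed auto

lemma nn_integral_translate:
  fixes f :: "real \<Rightarrow> ennreal"
  assumes [measurable]: "f \<in> borel_measurable borel"
  shows "(\<integral>\<^sup>+t. f (t + c) \<partial>lborel) = (\<integral>\<^sup>+t. f t \<partial>lborel)"
  using nn_integral_real_affine[OF assms, of 1 c] by (simp add: add.commute)

text \<open>The error \<open>f - g\<close> is paid once at \<open>t + c\<close> and once at
  \<open>t\<close>; translation invariance makes both payments equal, whence the factor 2.\<close>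

lemma L1_translation_approx:
  fixes f g :: "real \<Rightarrow> real"
  assumes [measurable]: "f \<in> borel_measurable borel" "g \<in> borel_measurable borel"
  shows "(\<integral>\<^sup>+t. ennreal \<bar>f (t + c) - f t\<bar> \<partial>lborel) \<le>
    (\<integral>\<^sup>+t. ennreal \<bar>g (t + c) - g t\<bar> \<partial>lborel) + 2 * (\<integral>\<^sup>+t. ennreal \<bar>f t - g t\<bar> \<partial>lborel)"
proof -
  have "(\<integral>\<^sup>+t. ennreal \<bar>f (t + c) - f t\<bar> \<partial>lborel)
      \<le> (\<integral>\<^sup>+t. (ennreal \<bar>g (t + c) - g t\<bar> + ennreal \<bar>f (t + c) - g (t + c)\<bar>) + ennreal \<bar>f t - g t\<bar> \<partial>lborel)"
    by (intro nn_integral_mono) (auto simp flip: ennreal_plus intro!: ennreal_leI)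
  also have "\<dots> = (\<integral>\<^sup>+t. ennreal \<bar>g (t + c) - g t\<bar> \<partial>lborel)
      + (\<integral>\<^sup>+t. ennreal \<bar>f (t + c) - g (t + c)\<bar> \<partial>lborel) + (\<integral>\<^sup>+t. ennreal \<bar>f t - g t\<bar> \<partial>lborel)"
    by (simp add: nn_integral_add)
  also have "(\<integral>\<^sup>+t. ennreal \<bar>f (t + c) - g (t + c)\<bar> \<partial>lborel) = (\<integral>\<^sup>+t. ennreal \<bar>f t - g t\<bar> \<partial>lborel)"
    by (rule nn_integral_translate[of "\<lambda>t. ennreal \<bar>f t - g t\<bar>"]) simp
  finally show ?thesis by (simp add: mult_2 add.assoc)
qed

text \<open>Induction over integrable functions. Outer regularity reduces indicators of Borel sets
  to open sets, and dominated convergence makes the limit case an L^1 approximation; both errors are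
  uniform in the size of the shift.\<close>

lemma L1_translation_tendsto:
  fixes f :: "real \<Rightarrow> real"
  assumes f: "integrable lborel f" and v: "v \<longlonglongrightarrow> 0"
  shows "(\<lambda>n. \<integral>\<^sup>+t. ennreal \<bar>f (t + v n) - f t\<bar> \<partial>lborel) \<longlonglongrightarrow> 0"
  using f
proof induction
  case (base A c)
  have [measurable]: "A \<in> sets borel" using base by simp
  have "(\<lambda>n. \<integral>\<^sup>+t. ennreal \<bar>indicator A (t + v n) - indicator A t\<bar> \<partial>lborel) \<longlonglongrightarrow> 0"
  proof (rule ennreal_tendsto_0_approx)
    fix e :: real assume e: "e > 0"
    \<comment> \<open>Half of \<open>e\<close>, because \<open>L1_translation_approx\<close> counts
      the approximation error twice.\<close>
    obtain U where U: "open U" "A \<subseteq> U" "emeasure lborel (U - A) < ennreal (e / 2)"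
      using outer_regular_lborel[of A "e / 2"] e base by auto
    have [measurable]: "U \<in> sets borel" using U by auto
    have "emeasure lborel U \<le> emeasure lborel A + emeasure lborel (U - A)"
      using U(2) by (intro order_trans[OF _ emeasure_subadditive] emeasure_mono) auto
    also have "\<dots> < \<infinity>" using base U(3) by (auto simp: ennreal_add_less_top less_top[symmetric])
    finally have fin: "emeasure lborel U < \<infinity>" .
    have "(\<integral>\<^sup>+t. ennreal \<bar>indicator A t - indicator U t\<bar> \<partial>lborel) = (\<integral>\<^sup>+t. indicator (U - A) t \<partial>lborel)"
      using U(2) by (intro nn_integral_cong) (auto simp: indicator_def)
    then have "2 * (\<integral>\<^sup>+t. ennreal \<bar>indicator A t - indicator U t\<bar> \<partial>lborel) \<le> 2 * ennreal (e / 2)"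
      using U(3) by (intro mult_left_mono) (auto intro: less_imp_le)
    also have "\<dots> = ennreal e" using e by (simp flip: ennreal_numeral ennreal_mult')
    finally have "2 * (\<integral>\<^sup>+t. ennreal \<bar>indicator A t - indicator U t\<bar> \<partial>lborel) \<le> ennreal e" .
    then show "\<exists>b. b \<longlonglongrightarrow> 0 \<and> (\<forall>n. (\<integral>\<^sup>+t. ennreal \<bar>indicator A (t + v n) - indicator A t\<bar> \<partial>lborel) \<le> b n + ennreal e)"
      by (intro exI[of _ "\<lambda>n. \<integral>\<^sup>+t. ennreal \<bar>indicator U (t + v n) - indicator U t\<bar> \<partial>lborel"] conjI allI
          L1_translation_tendsto_open[OF v U(1) fin]
          order_trans[OF L1_translation_approx[where g="indicator U"] add_left_mono]) auto
  qed
  from ennreal_tendsto_cmult[OF _ this, of "ennreal \<bar>c\<bar>"]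
  have "(\<lambda>n. ennreal \<bar>c\<bar> * (\<integral>\<^sup>+t. ennreal \<bar>indicator A (t + v n) - indicator A t\<bar> \<partial>lborel)) \<longlonglongrightarrow> 0"
    by simp
  also have "(\<lambda>n. ennreal \<bar>c\<bar> * (\<integral>\<^sup>+t. ennreal \<bar>indicator A (t + v n) - indicator A t\<bar> \<partial>lborel)) =
      (\<lambda>n. \<integral>\<^sup>+t. ennreal \<bar>indicator A (t + v n) *\<^sub>R c - indicator A t *\<^sub>R c\<bar> \<partial>lborel)"
    by (subst nn_integral_cmult[symmetric])
      (auto simp flip: ennreal_mult' simp: abs_mult[symmetric] algebra_simps intro!: ext nn_integral_cong)
  finally show ?case .
next
  case (add f g)
  have [measurable]: "f \<in> borel_measurable borel" "g \<in> borel_measurable borel" using add by auto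
  have "(\<integral>\<^sup>+t. ennreal \<bar>(f (t + v n) + g (t + v n)) - (f t + g t)\<bar> \<partial>lborel) \<le>
      (\<integral>\<^sup>+t. ennreal \<bar>f (t + v n) - f t\<bar> \<partial>lborel) + (\<integral>\<^sup>+t. ennreal \<bar>g (t + v n) - g t\<bar> \<partial>lborel)" (is "?l n \<le> ?r n") for n
    using nn_integral_abs_add_le[of "\<lambda>t. f (t + v n) - f t" lborel "\<lambda>t. g (t + v n) - g t"]
    by (simp add: algebra_simps)
  then have le: "\<forall>\<^sub>F n in sequentially. ?l n \<le> ?r n" by (rule always_eventually[OF allI])
  have "?r \<longlonglongrightarrow> 0" using tendsto_add[OF add.IH] by simp
  from tendsto_sandwich[OF _ le tendsto_const this] show ?case by simp
next
  case (lim f s)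
  have [measurable]: "f \<in> borel_measurable borel" "\<And>i. s i \<in> borel_measurable borel" using lim by auto
  have fin: "(\<integral>\<^sup>+t. ennreal (2 * norm (f t)) \<partial>lborel) < \<infinity>"
    using lim.hyps(4) by (simp add: integrable_iff_bounded ennreal_mult nn_integral_cmult ennreal_mult_less_top)
  have approx: "(\<lambda>i. \<integral>\<^sup>+t. ennreal (norm (f t - s i t)) \<partial>lborel) \<longlonglongrightarrow> 0"
    by (rule nn_integral_dominated_convergence_norm[where w="\<lambda>t. 2 * norm (f t)"])
      (use lim.hyps fin in auto)
  show ?case
  proof (rule ennreal_tendsto_0_approx)
    fix e :: real assume e: "e > 0"
    have "\<forall>\<^sub>F i in sequentially. (\<integral>\<^sup>+t. ennreal (norm (f t - s i t)) \<partial>lborel) < ennreal (e / 2)"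
      using order_tendstoD(2)[OF approx, of "ennreal (e / 2)"] e by simp
    then obtain i where i: "(\<integral>\<^sup>+t. ennreal \<bar>f t - s i t\<bar> \<partial>lborel) < ennreal (e / 2)"
      by (auto simp: eventually_sequentially)
    have "2 * (\<integral>\<^sup>+t. ennreal \<bar>f t - s i t\<bar> \<partial>lborel) \<le> 2 * ennreal (e / 2)"
      using i by (intro mult_left_mono) (auto intro: less_imp_le)
    also have "\<dots> = ennreal e" using e by (simp flip: ennreal_numeral ennreal_mult')
    finally have "2 * (\<integral>\<^sup>+t. ennreal \<bar>f t - s i t\<bar> \<partial>lborel) \<le> ennreal e" .
    then have "(\<integral>\<^sup>+t. ennreal \<bar>f (t + v n) - f t\<bar> \<partial>lborel)
        \<le> (\<integral>\<^sup>+t. ennreal \<bar>s i (t + v n) - s i t\<bar> \<partial>lborel) + ennreal e" for n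
      by (intro order_trans[OF L1_translation_approx[where g="s i"] add_left_mono]) auto
    with lim.IH[of i] show "\<exists>b. b \<longlonglongrightarrow> 0 \<and> (\<forall>n. (\<integral>\<^sup>+t. ennreal \<bar>f (t + v n) - f t\<bar> \<partial>lborel) \<le> b n + ennreal e)"
      by blast
  qed
qed

text \<open>Shifting mass with density \<open>q\<close> by \<open>s\<close> changes its distribution
  function at \<open>t\<close> by minus the mass near \<open>t\<close> over a length
  \<open>s\<close>, that is by \<open>- s * q t\<close> to first order. The error is an integral of
  \<open>q (t + v) - q t\<close> over shifts \<open>v\<close> no larger than \<open>s\<close>.
  Integrating in \<open>t\<close> first leaves only translation moduli in L^1, so \<open>q\<close>
  need not be continuous.\<close>

lemma nn_integral_increment_le:
  fixes q :: "real \<Rightarrow> real"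
  assumes q: "integrable lborel q" and e: "e > 0"
  obtains d where "d > 0" "\<And>s. \<bar>s\<bar> < d \<Longrightarrow>
    (\<integral>\<^sup>+t. ennreal \<bar>(\<integral>x. (indicator {..t} (x + s) - indicator {..t} x) * q x \<partial>lborel) + s * q t\<bar> \<partial>lborel)
      \<le> ennreal (\<bar>s\<bar> * e)"
proof -
  have [measurable]: "q \<in> borel_measurable borel" using q by simp
  have "((\<lambda>v. \<integral>\<^sup>+t. ennreal \<bar>q (t + v) - q t\<bar> \<partial>lborel) \<longlongrightarrow> 0) (at 0)"
    unfolding tendsto_at_iff_sequentially comp_def using L1_translation_tendsto[OF q] by blast
  then have "\<forall>\<^sub>F v in at 0. (\<integral>\<^sup>+t. ennreal \<bar>q (t + v) - q t\<bar> \<partial>lborel) < ennreal e"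
    using e by (intro order_tendstoD(2)) auto
  then obtain d where d: "d > 0" "\<And>v. v \<noteq> 0 \<Longrightarrow> \<bar>v\<bar> < d \<Longrightarrow> (\<integral>\<^sup>+t. ennreal \<bar>q (t + v) - q t\<bar> \<partial>lborel) < ennreal e"
    by (auto simp: eventually_at dist_real_def)
  then have dle: "(\<integral>\<^sup>+t. ennreal \<bar>q (t + v) - q t\<bar> \<partial>lborel) \<le> ennreal e" if "\<bar>v\<bar> < d" for v
    using that by (cases "v = 0") (auto intro: less_imp_le)
  show ?thesis
  proof
    show "d > 0" by fact
    fix s :: real assume s: "\<bar>s\<bar> < d"
    \<comment> \<open>The offsets \<open>x - t\<close> at which the shift changes whether a point
      counts as at most \<open>t\<close>. For positive \<open>s\<close> these points are lost, for
      negative \<open>s\<close> gained, which is the sign in \<open>c\<close>; the half-open form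
      matches the weak inequality in the distribution function.\<close>
    define J where "J = {min 0 (- s)<..max 0 (- s)}"
    define c where "c v = (if s \<le> 0 then indicator J v else - indicator J v :: real)" for v :: real
    have [measurable]: "J \<in> sets borel" by (simp add: J_def)
    have [measurable]: "c \<in> borel_measurable borel" unfolding c_def[abs_def] by (cases "s \<le> 0") simp_all
    have emJ: "emeasure lborel J = ennreal \<bar>s\<bar>" by (auto simp: J_def min_def max_def)
    have mJ: "measure lborel J = \<bar>s\<bar>" by (simp add: measure_def emJ)
    have Js: "\<bar>v\<bar> < d" if "v \<in> J" for v using that s by (auto simp: J_def min_def max_def split: if_splits)
    have absc: "\<bar>c v\<bar> = indicator J v" for v by (simp add: c_def)
    have cq: "indicator {..t} (x + s) - indicator {..t} x = c (x - t)" for t x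
      by (auto simp: c_def J_def indicator_def min_def max_def)
    have intc: "integrable lborel c" "(\<integral>v. c v \<partial>lborel) = - s"
      unfolding c_def[abs_def] using emJ mJ by (cases "s \<le> 0"; simp)+
    have qt: "integrable lborel (\<lambda>v. q (t + v))" for t
      using lborel_integrable_real_affine[OF q, of 1 t] by simp
    have cqi: "integrable lborel (\<lambda>v. c v * q (t + v))" for t
      by (rule Bochner_Integration.integrable_bound[OF qt[of t]]) (auto simp: abs_mult absc indicator_def)
    have le: "ennreal \<bar>(\<integral>x. (indicator {..t} (x + s) - indicator {..t} x) * q x \<partial>lborel) + s * q t\<bar>
        \<le> (\<integral>\<^sup>+v. indicator J v * ennreal \<bar>q (t + v) - q t\<bar> \<partial>lborel)" for t
    proof -
      have "(\<integral>x. (indicator {..t} (x + s) - indicator {..t} x) * q x \<partial>lborel) = (\<integral>v. c v * q (t + v) \<partial>lborel)"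
        unfolding cq by (subst lborel_integral_real_affine[where c=1 and t=t]) auto
      moreover have "s * q t = - (\<integral>v. c v * q t \<partial>lborel)" using intc by simp
      ultimately have "(\<integral>x. (indicator {..t} (x + s) - indicator {..t} x) * q x \<partial>lborel) + s * q t
          = (\<integral>v. c v * (q (t + v) - q t) \<partial>lborel)"
        using intc cqi by (simp add: right_diff_distrib)
      moreover have "integrable lborel (\<lambda>v. c v * (q (t + v) - q t))"
        using intc cqi by (simp add: right_diff_distrib)
      ultimately have "ennreal \<bar>(\<integral>x. (indicator {..t} (x + s) - indicator {..t} x) * q x \<partial>lborel) + s * q t\<bar>
          \<le> (\<integral>\<^sup>+v. ennreal \<bar>c v * (q (t + v) - q t)\<bar> \<partial>lborel)"
        using integral_norm_bound_ennreal[of lborel "\<lambda>v. c v * (q (t + v) - q t)"] by simp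
      also have "\<dots> = (\<integral>\<^sup>+v. indicator J v * ennreal \<bar>q (t + v) - q t\<bar> \<partial>lborel)"
        by (intro nn_integral_cong) (auto simp: abs_mult absc indicator_def)
      finally show ?thesis .
    qed
    have "(\<integral>\<^sup>+t. ennreal \<bar>(\<integral>x. (indicator {..t} (x + s) - indicator {..t} x) * q x \<partial>lborel) + s * q t\<bar> \<partial>lborel)
        \<le> (\<integral>\<^sup>+t. (\<integral>\<^sup>+v. indicator J v * ennreal \<bar>q (t + v) - q t\<bar> \<partial>lborel) \<partial>lborel)"
      by (intro nn_integral_mono le)
    also have "\<dots> = (\<integral>\<^sup>+v. (\<integral>\<^sup>+t. indicator J v * ennreal \<bar>q (t + v) - q t\<bar> \<partial>lborel) \<partial>lborel)"
      by (subst lborel_pair.Fubini') auto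
    also have "\<dots> \<le> (\<integral>\<^sup>+v. indicator J v * ennreal e \<partial>lborel)"
      using Js dle by (intro nn_integral_mono) (auto simp: nn_integral_cmult indicator_def)
    also have "\<dots> = ennreal (\<bar>s\<bar> * e)"
      using e by (simp add: nn_integral_multc emJ ennreal_mult)
    finally show "(\<integral>\<^sup>+t. ennreal \<bar>(\<integral>x. (indicator {..t} (x + s) - indicator {..t} x) * q x \<partial>lborel) + s * q t\<bar> \<partial>lborel)
      \<le> ennreal (\<bar>s\<bar> * e)" .
  qed
qed

subsection \<open>Perturbations with vanishing conditional mean\<close>

text \<open>The law of \<open>X\<close> restricted to the event is dominated by the law of
  \<open>X\<close>, so it inherits absolute continuity and Radon-Nikodym applies. Its mass is at
  most 1, hence the density is finite almost everywhere and may be taken real.\<close>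

lemma (in prob_space) event_density:
  fixes X :: "'a \<Rightarrow> real"
  assumes [measurable]: "random_variable borel X" "A \<in> events"
    and ac: "absolutely_continuous lborel (distr M borel X)"
  obtains q :: "real \<Rightarrow> real" where "integrable lborel q"
    "\<And>B. B \<in> sets borel \<Longrightarrow> prob {\<omega>\<in>A. X \<omega> \<in> B} = (\<integral>x. indicator B x * q x \<partial>lborel)"
proof -
  define D where "D = distr (density M (indicator A)) borel X"
  have D: "emeasure D B = ennreal (prob {\<omega>\<in>A. X \<omega> \<in> B})" if [measurable]: "B \<in> sets borel" for B
  proof -
    have "emeasure D B = (\<integral>\<^sup>+\<omega>. indicator A \<omega> * indicator (X -` B \<inter> space M) \<omega> \<partial>M)"
      by (simp add: D_def emeasure_distr emeasure_density)
    also have "\<dots> = (\<integral>\<^sup>+\<omega>. indicator {\<omega>\<in>A. X \<omega> \<in> B} \<omega> \<partial>M)"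
      using sets.sets_into_space[OF assms(2)] by (intro nn_integral_cong) (auto simp: indicator_def)
    also have "\<dots> = emeasure M {\<omega>\<in>A. X \<omega> \<in> B}" by (rule nn_integral_indicator) measurable
    finally show ?thesis by (simp add: emeasure_eq_measure)
  qed
  have "absolutely_continuous lborel D"
    unfolding absolutely_continuous_def
  proof
    fix B :: "real set" assume B: "B \<in> null_sets lborel"
    then have [measurable]: "B \<in> sets borel" by auto
    have "B \<in> null_sets (distr M borel X)" using ac B by (auto simp: absolutely_continuous_def)
    then have "emeasure M (X -` B \<inter> space M) = 0" by (auto simp: emeasure_distr)
    then have "prob (X -` B \<inter> space M) = 0" by (simp add: measure_def)
    moreover have "prob {\<omega>\<in>A. X \<omega> \<in> B} \<le> prob (X -` B \<inter> space M)"
      using sets.sets_into_space[OF assms(2)] by (intro finite_measure_mono) auto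
    ultimately show "B \<in> null_sets D" using measure_nonneg[of M "{\<omega>\<in>A. X \<omega> \<in> B}"]
      by (auto simp: D null_sets_def) (simp add: D_def)
  qed
  then obtain f where f[measurable]: "f \<in> borel_measurable borel" and fD: "density lborel f = D"
    using sigma_finite_measure.Radon_Nikodym[OF sigma_finite_lborel, of D] by (auto simp: D_def)
  have int_f: "(\<integral>\<^sup>+x. f x * indicator B x \<partial>lborel) = ennreal (prob {\<omega>\<in>A. X \<omega> \<in> B})" if "B \<in> sets borel" for B
    using D[OF that] that by (simp flip: fD add: emeasure_density)
  have "(\<integral>\<^sup>+x. f x \<partial>lborel) < \<infinity>" using int_f[of UNIV] by simp
  then have fin: "AE x in lborel. ennreal (enn2real (f x)) = f x"
    using nn_integral_noteq_infinite[of f lborel] by (auto elim!: eventually_mono simp: less_top)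
  show ?thesis
  proof
    show "integrable lborel (\<lambda>x. enn2real (f x))"
    proof (rule integrableI_nonneg)
      have "(\<integral>\<^sup>+x. ennreal (enn2real (f x)) \<partial>lborel) = (\<integral>\<^sup>+x. f x \<partial>lborel)"
        using fin by (intro nn_integral_cong_AE) auto
      then show "(\<integral>\<^sup>+x. ennreal (enn2real (f x)) \<partial>lborel) < \<infinity>" using int_f[of UNIV] by simp
    qed auto
    fix B :: "real set" assume B[measurable]: "B \<in> sets borel"
    have "(\<integral>x. indicator B x * enn2real (f x) \<partial>lborel) = enn2real (\<integral>\<^sup>+x. ennreal (indicator B x * enn2real (f x)) \<partial>lborel)"
      by (intro integral_eq_nn_integral) auto
    also have "(\<integral>\<^sup>+x. ennreal (indicator B x * enn2real (f x)) \<partial>lborel) = (\<integral>\<^sup>+x. f x * indicator B x \<partial>lborel)"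
      using fin by (intro nn_integral_cong_AE) (auto elim!: eventually_mono simp: indicator_def)
    finally show "prob {\<omega>\<in>A. X \<omega> \<in> B} = (\<integral>x. indicator B x * enn2real (f x) \<partial>lborel)"
      by (simp add: int_f)
  qed
qed

text \<open>On the piece \<open>A j\<close> the variable is translated by the constant
  \<open>r * z j\<close>, so \<open>nn_integral_increment_le\<close> applies to the density of
  \<open>X\<close> on that piece. The first-order terms sum to \<open>- r * m t\<close>, whose L^1
  norm is at most \<open>2 * a\<close> times \<open>r\<close>; the remainders fit into
  \<open>r * e\<close>.\<close>

lemma (in prob_space) W1_perturbation_simple:
  fixes X S :: "'a \<Rightarrow> real" and J :: "'i set"
  assumes [measurable]: "random_variable borel X"
    and ac: "absolutely_continuous lborel (distr M borel X)"
    and J: "finite J" and A: "\<And>j. j \<in> J \<Longrightarrow> A j \<in> events" "disjoint_family_on A J" "(\<Union>j\<in>J. A j) = space M"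
    and S: "\<And>j \<omega>. j \<in> J \<Longrightarrow> \<omega> \<in> A j \<Longrightarrow> S \<omega> = z j"
    and mean: "\<And>B. B \<in> sets borel \<Longrightarrow> \<bar>\<integral>\<omega>. S \<omega> * indicator B (X \<omega>) \<partial>M\<bar> \<le> a"
    and e: "e > 0"
  shows "\<forall>\<^sub>F r in at_right 0.
    (\<integral>\<^sup>+t. ennreal \<bar>prob {\<omega>\<in>space M. X \<omega> + r * S \<omega> \<le> t} - prob {\<omega>\<in>space M. X \<omega> \<le> t}\<bar> \<partial>lborel)
      \<le> ennreal (r * (2 * a + e))"
proof -
  have "\<exists>q. integrable lborel q \<and> (\<forall>B\<in>sets borel. prob {\<omega>\<in>A j. X \<omega> \<in> B} = (\<integral>x. indicator B x * q x \<partial>lborel))"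
    if "j \<in> J" for j
    using event_density[OF assms(1) A(1)[OF that] ac] by metis
  then obtain q where q: "\<And>j. j \<in> J \<Longrightarrow> integrable lborel (q j)"
    and qB: "\<And>j B. j \<in> J \<Longrightarrow> B \<in> sets borel \<Longrightarrow> prob {\<omega>\<in>A j. X \<omega> \<in> B} = (\<integral>x. indicator B x * q j x \<partial>lborel)"
    by metis
  have [measurable]: "j \<in> J \<Longrightarrow> q j \<in> borel_measurable borel" for j using q[of j] by simp
  \<comment> \<open>By \<open>m_B\<close> this is the density of the signed measure taking
    \<open>B\<close> to the mean of \<open>S\<close> on the event that \<open>X\<close> lies in
    \<open>B\<close>: the conditional mean of \<open>S\<close> given \<open>X\<close>, times the
    density of \<open>X\<close>.\<close>
  define m where "m t = (\<Sum>j\<in>J. z j * q j t)" for t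
  have m_int: "integrable lborel m" unfolding m_def[abs_def] using q by auto
  have [measurable]: "m \<in> borel_measurable borel" using m_int by simp
  have AJ: "A j \<subseteq> space M" if "j \<in> J" for j using A(3) that by auto
  have S_sum: "S \<omega> = (\<Sum>j\<in>J. z j * indicator (A j) \<omega>)" if \<omega>: "\<omega> \<in> space M" for \<omega>
  proof -
    obtain i where i: "i \<in> J" "\<omega> \<in> A i" using \<omega> A(3) by auto
    have "(\<Sum>j\<in>J. z j * indicator (A j) \<omega>) = (\<Sum>j\<in>J. if j = i then z j else 0)"
    proof (intro sum.cong refl)
      fix j assume "j \<in> J"
      then show "z j * indicator (A j) \<omega> = (if j = i then z j else 0)"
        using i disjoint_family_onD[OF A(2), of j i] by (cases "j = i") (auto simp: indicator_def)
    qed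
    then show ?thesis using i J S by simp
  qed
  have m_B: "(\<integral>x. indicator B x * m x \<partial>lborel) = (\<integral>\<omega>. S \<omega> * indicator B (X \<omega>) \<partial>M)"
    if [measurable]: "B \<in> sets borel" for B
  proof -
    have qi: "integrable lborel (\<lambda>x. indicator B x * q j x)" if "j \<in> J" for j
      using integrable_mult_indicator[OF _ q[OF that], of B] by simp
    have AB: "{\<omega>\<in>A j. X \<omega> \<in> B} \<in> events" if "j \<in> J" for j using A(1)[OF that] by measurable
    have "(\<integral>x. indicator B x * m x \<partial>lborel) = (\<integral>x. (\<Sum>j\<in>J. z j * (indicator B x * q j x)) \<partial>lborel)"
      by (simp add: m_def sum_distrib_left algebra_simps)
    also have "\<dots> = (\<Sum>j\<in>J. z j * (\<integral>x. indicator B x * q j x \<partial>lborel))"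
      using qi by (subst Bochner_Integration.integral_sum) auto
    also have "\<dots> = (\<Sum>j\<in>J. z j * (\<integral>\<omega>. indicator {\<omega>\<in>A j. X \<omega> \<in> B} \<omega> \<partial>M))"
      using AB AJ by (intro sum.cong refl arg_cong2[where f="(*)"]) (auto simp: qB[symmetric] intro!: arg_cong[where f=prob])
    also have "\<dots> = (\<integral>\<omega>. (\<Sum>j\<in>J. z j * indicator {\<omega>\<in>A j. X \<omega> \<in> B} \<omega>) \<partial>M)"
      using AB by (subst Bochner_Integration.integral_sum) (auto simp: integrable_indicator_iff emeasure_eq_measure)
    also have "\<dots> = (\<integral>\<omega>. S \<omega> * indicator B (X \<omega>) \<partial>M)"
      by (intro Bochner_Integration.integral_cong refl) (auto simp: S_sum sum_distrib_right indicator_def intro!: sum.cong)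
    finally show ?thesis .
  qed
  \<comment> \<open>The hypothesis \<open>mean\<close> is applied to the sets where \<open>m\<close>
    is nonnegative and where it is negative, each contributing at most \<open>a\<close>.\<close>
  have m_norm: "(\<integral>\<^sup>+t. ennreal \<bar>m t\<bar> \<partial>lborel) \<le> ennreal (2 * a)"
  proof -
    let ?P = "{t. 0 \<le> m t}" and ?N = "{t. m t < 0}"
    have i: "integrable lborel (\<lambda>x. indicator B x * m x)" if "B \<in> sets borel" for B
      using integrable_mult_indicator[OF _ m_int, of B] that by simp
    have "(\<integral>\<^sup>+t. ennreal \<bar>m t\<bar> \<partial>lborel) = ennreal (\<integral>t. \<bar>m t\<bar> \<partial>lborel)"
      using m_int by (intro nn_integral_eq_integral) auto
    also have "(\<integral>t. \<bar>m t\<bar> \<partial>lborel) = (\<integral>t. indicator ?P t * m t - indicator ?N t * m t \<partial>lborel)"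
      by (intro Bochner_Integration.integral_cong) (auto simp: indicator_def)
    also have "\<dots> = (\<integral>t. indicator ?P t * m t \<partial>lborel) - (\<integral>t. indicator ?N t * m t \<partial>lborel)"
      by (intro Bochner_Integration.integral_diff i) auto
    also have "\<dots> \<le> a + a" using mean[of ?P] mean[of ?N] by (simp add: m_B)
    finally show ?thesis by (simp add: ennreal_leI)
  qed
  \<comment> \<open>The tolerance per unit of shift, chosen so that the pieces together cost at most
    \<open>e\<close>; the added 1 keeps the denominator positive when every \<open>z j\<close> is
    0.\<close>
  define b where "b = e / (1 + (\<Sum>j\<in>J. \<bar>z j\<bar>))"
  have pos: "0 < 1 + (\<Sum>j\<in>J. \<bar>z j\<bar>)" by (intro add_pos_nonneg sum_nonneg) auto
  have b: "b > 0" unfolding b_def using e pos by (rule divide_pos_pos)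
  have bz: "(\<Sum>j\<in>J. \<bar>z j\<bar>) * b \<le> e" using e pos by (simp add: b_def field_simps)
  define \<Delta> where "\<Delta> j s t = (\<integral>x. (indicator {..t} (x + s) - indicator {..t} x) * q j x \<partial>lborel)" for j s t
  have [measurable]: "\<Delta> j s \<in> borel_measurable borel" if "j \<in> J" for j s
  proof -
    have [measurable]: "q j \<in> borel_measurable borel" using q[OF that] by simp
    have "(\<lambda>(t, x). (indicator {..t} (x + s) - indicator {..t} x) * q j x) \<in> borel_measurable (borel \<Otimes>\<^sub>M lborel)"
      unfolding indicator_def atMost_iff by measurable
    then show ?thesis unfolding \<Delta>_def[abs_def] by (rule lborel.borel_measurable_lebesgue_integral)
  qed
  have "\<forall>\<^sub>F r in at_right 0. \<forall>j\<in>J. (\<integral>\<^sup>+t. ennreal \<bar>\<Delta> j (r * z j) t + r * z j * q j t\<bar> \<partial>lborel) \<le> ennreal (\<bar>r * z j\<bar> * b)"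
  proof (rule eventually_ball_finite[OF J], rule ballI)
    fix j assume j: "j \<in> J"
    obtain d where d: "d > 0" "\<And>s. \<bar>s\<bar> < d \<Longrightarrow> (\<integral>\<^sup>+t. ennreal \<bar>\<Delta> j s t + s * q j t\<bar> \<partial>lborel) \<le> ennreal (\<bar>s\<bar> * b)"
      unfolding \<Delta>_def by (rule nn_integral_increment_le[OF q[OF j] b]) blast
    have "((\<lambda>r. r * z j) \<longlongrightarrow> 0) (at_right 0)" by (auto intro!: tendsto_eq_intros)
    then have "\<forall>\<^sub>F r in at_right 0. \<bar>r * z j\<bar> < d"
      using d(1) by (auto dest!: tendstoD simp: dist_real_def)
    then show "\<forall>\<^sub>F r in at_right 0. (\<integral>\<^sup>+t. ennreal \<bar>\<Delta> j (r * z j) t + r * z j * q j t\<bar> \<partial>lborel) \<le> ennreal (\<bar>r * z j\<bar> * b)"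
      by eventually_elim (rule d(2))
  qed
  moreover have "\<forall>\<^sub>F r in at_right (0::real). 0 < r" by (rule eventually_at_right_less)
  ultimately show ?thesis
  proof eventually_elim
    case (elim r)
    have "prob {\<omega>\<in>space M. X \<omega> + r * S \<omega> \<le> t} - prob {\<omega>\<in>space M. X \<omega> \<le> t}
        = (\<Sum>j\<in>J. \<Delta> j (r * z j) t + r * z j * q j t) + (- r * m t)" for t
    proof -
      have split: "prob E = (\<Sum>j\<in>J. prob (E \<inter> A j))" if E: "E \<in> events" for E
      proof -
        have "E = (\<Union>j\<in>J. E \<inter> A j)" using A(3) sets.sets_into_space[OF E] by auto
        then have "prob E = prob (\<Union>j\<in>J. E \<inter> A j)" by simp
        also have "\<dots> = (\<Sum>j\<in>J. prob (E \<inter> A j))"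
          using J A E by (intro finite_measure_finite_Union) (auto simp: disjoint_family_on_def)
        finally show ?thesis .
      qed
      have ev: "{\<omega>\<in>space M. X \<omega> + s * S \<omega> \<le> t} \<in> events" for s
      proof -
        have "{\<omega>\<in>space M. X \<omega> + s * S \<omega> \<le> t} = {\<omega>\<in>space M. X \<omega> + s * (\<Sum>j\<in>J. z j * indicator (A j) \<omega>) \<le> t}"
          using S_sum by auto
        also have "\<dots> \<in> events" using A(1) by measurable
        finally show ?thesis .
      qed
      have pj: "prob ({\<omega>\<in>space M. X \<omega> + s * S \<omega> \<le> t} \<inter> A j) = (\<integral>x. indicator {..t} (x + s * z j) * q j x \<partial>lborel)"
        if j: "j \<in> J" for s j
      proof -
        have eq: "{\<omega>\<in>space M. X \<omega> + s * S \<omega> \<le> t} \<inter> A j = {\<omega>\<in>A j. X \<omega> \<in> {..t - s * z j}}"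
          using AJ[OF j] S[OF j] by auto
        show ?thesis unfolding eq by (subst qB[OF j])
            (auto intro!: Bochner_Integration.integral_cong split: split_indicator)
      qed
      have qi: "integrable lborel (\<lambda>x. indicator {..t} (x + s) * q j x)" if "j \<in> J" for j s
        by (rule Bochner_Integration.integrable_bound[OF q[OF that]]) (use that in \<open>auto simp: indicator_def\<close>)
      \<comment> \<open>The unperturbed probability is written with the factor 0 so that
        \<open>pj\<close> evaluates both terms.\<close>
      have "prob {\<omega>\<in>space M. X \<omega> + r * S \<omega> \<le> t} - prob {\<omega>\<in>space M. X \<omega> + 0 * S \<omega> \<le> t}
          = (\<Sum>j\<in>J. (\<integral>x. indicator {..t} (x + r * z j) * q j x \<partial>lborel) - (\<integral>x. indicator {..t} (x + 0 * z j) * q j x \<partial>lborel))"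
        unfolding split[OF ev] by (simp only: pj sum_subtractf cong: sum.cong)
      also have "\<dots> = (\<Sum>j\<in>J. \<Delta> j (r * z j) t)"
        using qi qi[of _ 0] by (intro sum.cong) (auto simp: \<Delta>_def left_diff_distrib)
      also have "\<dots> = (\<Sum>j\<in>J. \<Delta> j (r * z j) t + r * z j * q j t) + (- r * m t)"
        by (simp add: m_def sum.distrib sum_distrib_left mult.assoc sum_negf)
      finally show ?thesis by simp
    qed
    then have "(\<integral>\<^sup>+t. ennreal \<bar>prob {\<omega>\<in>space M. X \<omega> + r * S \<omega> \<le> t} - prob {\<omega>\<in>space M. X \<omega> \<le> t}\<bar> \<partial>lborel)
      \<le> (\<integral>\<^sup>+t. ennreal \<bar>\<Sum>j\<in>J. \<Delta> j (r * z j) t + r * z j * q j t\<bar> \<partial>lborel) + (\<integral>\<^sup>+t. ennreal \<bar>- r * m t\<bar> \<partial>lborel)"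
      by (simp only:) (rule nn_integral_abs_add_le; measurable)
    also have "(\<integral>\<^sup>+t. ennreal \<bar>- r * m t\<bar> \<partial>lborel) = ennreal r * (\<integral>\<^sup>+t. ennreal \<bar>m t\<bar> \<partial>lborel)"
      using elim(2) by (subst nn_integral_cmult[symmetric]) (auto simp: abs_mult ennreal_mult)
    also have "\<dots> \<le> ennreal r * ennreal (2 * a)" by (intro mult_left_mono m_norm) simp
    also have "(\<integral>\<^sup>+t. ennreal \<bar>\<Sum>j\<in>J. \<Delta> j (r * z j) t + r * z j * q j t\<bar> \<partial>lborel)
        \<le> (\<integral>\<^sup>+t. (\<Sum>j\<in>J. ennreal \<bar>\<Delta> j (r * z j) t + r * z j * q j t\<bar>) \<partial>lborel)"
      by (intro nn_integral_mono) (auto simp: sum_ennreal intro!: ennreal_leI sum_abs)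
    also have "\<dots> = (\<Sum>j\<in>J. \<integral>\<^sup>+t. ennreal \<bar>\<Delta> j (r * z j) t + r * z j * q j t\<bar> \<partial>lborel)"
      by (rule nn_integral_sum) measurable
    also have "\<dots> \<le> (\<Sum>j\<in>J. ennreal (\<bar>r * z j\<bar> * b))" using elim by (intro sum_mono) auto
    also have "\<dots> = ennreal (r * ((\<Sum>j\<in>J. \<bar>z j\<bar>) * b))"
      using elim(2) b by (simp add: sum_ennreal abs_mult sum_distrib_left sum_distrib_right mult.assoc)
    also have "\<dots> \<le> ennreal (r * e)" using bz elim(2) by (intro ennreal_leI mult_left_mono) auto
    \<comment> \<open>Adding in \<open>ennreal\<close> needs \<open>0 \<le> a\<close>, which is what
      \<open>mean\<close> says of the empty set.\<close>
    also have "ennreal (r * e) + ennreal r * ennreal (2 * a) = ennreal (r * (2 * a + e))"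
      using elim(2) e mean[of "{}"] by (simp add: ennreal_mult'[symmetric] ennreal_plus[symmetric] algebra_simps del: ennreal_plus)
    finally show ?case by (auto simp: add_mono)
  qed
qed

text \<open>Rounding \<open>W\<close> down to a grid of mesh \<open>\<eta>\<close> gives a simple
  \<open>S\<close> within \<open>\<eta>\<close> of \<open>W\<close>. The exchange costs
  \<open>r * \<eta>\<close>, and the means of \<open>S\<close> over events of \<open>X\<close> are
  now only bounded by \<open>\<eta>\<close>, so the simple case costs
  \<open>r * (2 * \<eta> + \<eta>)\<close>. In total this is four times \<open>\<eta>\<close>,
  whence \<open>\<eta> = e / 4\<close>.\<close>

lemma (in prob_space) W1_perturbation:
  fixes X W :: "'a \<Rightarrow> real"
  assumes [measurable]: "random_variable borel X" "random_variable borel W"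
    and ac: "absolutely_continuous lborel (distr M borel X)"
    and W: "\<And>\<omega>. \<omega> \<in> space M \<Longrightarrow> \<bar>W \<omega>\<bar> \<le> K"
    and mean: "\<And>B. B \<in> sets borel \<Longrightarrow> (\<integral>\<omega>. W \<omega> * indicator B (X \<omega>) \<partial>M) = 0"
    and e: "e > 0"
  shows "\<forall>\<^sub>F r in at_right 0.
    (\<integral>\<^sup>+t. ennreal \<bar>prob {\<omega>\<in>space M. X \<omega> + r * W \<omega> \<le> t} - prob {\<omega>\<in>space M. X \<omega> \<le> t}\<bar> \<partial>lborel)
      \<le> ennreal (r * e)"
proof -
  define \<eta> where "\<eta> = e / 4"
  have \<eta>: "\<eta> > 0" using e by (simp add: \<eta>_def)
  define S where "S \<omega> = \<eta> * of_int \<lfloor>W \<omega> / \<eta>\<rfloor>" for \<omega>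
  have [measurable]: "random_variable borel S" unfolding S_def[abs_def] by measurable
  have SW: "\<bar>W \<omega> - S \<omega>\<bar> \<le> \<eta>" for \<omega>
  proof -
    have "\<bar>W \<omega> / \<eta> - of_int \<lfloor>W \<omega> / \<eta>\<rfloor>\<bar> \<le> 1" by linarith
    then have "\<eta> * \<bar>W \<omega> / \<eta> - of_int \<lfloor>W \<omega> / \<eta>\<rfloor>\<bar> \<le> \<eta>" using \<eta> by (simp add: mult_left_le)
    then have "\<bar>\<eta> * (W \<omega> / \<eta> - of_int \<lfloor>W \<omega> / \<eta>\<rfloor>)\<bar> \<le> \<eta>" using \<eta> by (simp add: abs_mult)
    then show ?thesis using \<eta> by (simp add: S_def right_diff_distrib)
  qed
  have Wi: "integrable M (\<lambda>\<omega>. W \<omega> * indicator B (X \<omega>))" if [measurable]: "B \<in> sets borel" for B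
    using W by (intro integrable_const_bound[of _ "\<bar>K\<bar>"]) (auto simp: indicator_def intro!: AE_I2 order_trans[OF _ abs_ge_self])
  have Si: "integrable M (\<lambda>\<omega>. (S \<omega> - W \<omega>) * indicator B (X \<omega>))" if [measurable]: "B \<in> sets borel" for B
    using SW \<eta> by (intro integrable_const_bound[of _ \<eta>]) (auto simp: indicator_def abs_minus_commute)
  define J where "J = {\<lfloor>-K / \<eta>\<rfloor>..\<lfloor>K / \<eta>\<rfloor>}"
  have ev: "\<forall>\<^sub>F r in at_right 0.
    (\<integral>\<^sup>+t. ennreal \<bar>prob {\<omega>\<in>space M. X \<omega> + r * S \<omega> \<le> t} - prob {\<omega>\<in>space M. X \<omega> \<le> t}\<bar> \<partial>lborel)
      \<le> ennreal (r * (2 * \<eta> + \<eta>))"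
  proof (rule W1_perturbation_simple[where J=J and A="\<lambda>j. {\<omega>\<in>space M. \<lfloor>W \<omega> / \<eta>\<rfloor> = j}" and z="\<lambda>j. \<eta> * of_int j"])
    show "(\<Union>j\<in>J. {\<omega>\<in>space M. \<lfloor>W \<omega> / \<eta>\<rfloor> = j}) = space M"
    proof -
      have "\<lfloor>W \<omega> / \<eta>\<rfloor> \<in> J" if "\<omega> \<in> space M" for \<omega>
      proof -
        have "- K / \<eta> \<le> W \<omega> / \<eta>" "W \<omega> / \<eta> \<le> K / \<eta>"
          using W[OF that] \<eta> by (intro divide_right_mono; simp)+
        then show ?thesis by (auto simp: J_def simp del: minus_divide_left intro!: floor_mono)
      qed
      then show ?thesis by auto
    qed
    fix B :: "real set" assume B[measurable]: "B \<in> sets borel"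
    have "(\<integral>\<omega>. S \<omega> * indicator B (X \<omega>) \<partial>M) =
        (\<integral>\<omega>. (S \<omega> - W \<omega>) * indicator B (X \<omega>) + W \<omega> * indicator B (X \<omega>) \<partial>M)"
      by (simp add: algebra_simps)
    also have "\<dots> = (\<integral>\<omega>. (S \<omega> - W \<omega>) * indicator B (X \<omega>) \<partial>M)"
      using Si[OF B] Wi[OF B] by (simp add: mean)
    also have "\<bar>\<dots>\<bar> \<le> (\<integral>\<omega>. \<eta> \<partial>M)"
      using SW \<eta> Si[OF B] by (intro order_trans[OF integral_abs_bound] integral_mono) (auto simp: indicator_def abs_minus_commute)
    finally show "\<bar>\<integral>\<omega>. S \<omega> * indicator B (X \<omega>) \<partial>M\<bar> \<le> \<eta>" by (simp add: prob_space)
  qed (use \<eta> ac in \<open>auto simp: J_def disjoint_family_on_def S_def\<close>)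
  have "\<forall>\<^sub>F r in at_right (0::real). 0 < r" by (rule eventually_at_right_less)
  with ev show ?thesis
  proof eventually_elim
    case (elim r)
    let ?p = "\<lambda>(Y :: 'a \<Rightarrow> real) t. prob {\<omega>\<in>space M. Y \<omega> \<le> t}"
    have [measurable]: "random_variable borel Y \<Longrightarrow> (\<lambda>t. ?p Y t) \<in> borel_measurable borel" for Y
      by (intro borel_measurable_mono) (auto intro!: monoI finite_measure_mono)
    have "(\<integral>\<^sup>+t. ennreal \<bar>?p (\<lambda>\<omega>. X \<omega> + r * W \<omega>) t - ?p X t\<bar> \<partial>lborel)
        = (\<integral>\<^sup>+t. ennreal \<bar>(?p (\<lambda>\<omega>. X \<omega> + r * W \<omega>) t - ?p (\<lambda>\<omega>. X \<omega> + r * S \<omega>) t)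
            + (?p (\<lambda>\<omega>. X \<omega> + r * S \<omega>) t - ?p X t)\<bar> \<partial>lborel)" by simp
    also have "\<dots> \<le> (\<integral>\<^sup>+t. ennreal \<bar>?p (\<lambda>\<omega>. X \<omega> + r * W \<omega>) t - ?p (\<lambda>\<omega>. X \<omega> + r * S \<omega>) t\<bar> \<partial>lborel)
        + (\<integral>\<^sup>+t. ennreal \<bar>?p (\<lambda>\<omega>. X \<omega> + r * S \<omega>) t - ?p X t\<bar> \<partial>lborel)"
      by (rule nn_integral_abs_add_le) measurable
    also have "\<dots> \<le> (\<integral>\<^sup>+\<omega>. ennreal \<bar>(X \<omega> + r * W \<omega>) - (X \<omega> + r * S \<omega>)\<bar> \<partial>M) + ennreal (r * (2 * \<eta> + \<eta>))"
      using elim by (intro add_mono nn_integral_cdf_diff_le) auto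
    also have "(\<integral>\<^sup>+\<omega>. ennreal \<bar>(X \<omega> + r * W \<omega>) - (X \<omega> + r * S \<omega>)\<bar> \<partial>M) \<le> (\<integral>\<^sup>+\<omega>. ennreal (r * \<eta>) \<partial>M)"
      using SW elim(2) by (intro nn_integral_mono ennreal_leI) (auto simp: abs_mult right_diff_distrib[symmetric])
    also have "\<dots> + ennreal (r * (2 * \<eta> + \<eta>)) = ennreal (r * e)"
      using elim(2) \<eta> by (simp add: emeasure_space_1 \<eta>_def ennreal_plus[symmetric] algebra_simps del: ennreal_plus)
    finally show ?case by (auto simp: add_right_mono)
  qed
qed

text \<open>The last two bounds on \<open>E\<close> together make \<open>E r\<close> of order \<open>o(r)\<close> in every \<open>L\<^sup>p\<close>.\<close>

definition correction :: "'a measure \<Rightarrow> real \<Rightarrow> ('a \<Rightarrow> real) \<Rightarrow> ('a \<Rightarrow> real) \<Rightarrow> ('a \<Rightarrow> real) \<Rightarrow>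
    (real \<Rightarrow> 'a \<Rightarrow> real) \<Rightarrow> (real \<Rightarrow> 'a \<Rightarrow> real) \<Rightarrow> bool" where
  "correction M K X Z a V E \<longleftrightarrow>
    (\<forall>r>0. V r \<in> borel_measurable M \<and> E r \<in> borel_measurable M \<and> distr M borel (V r) = distr M borel X) \<and>
    (\<forall>r>0. r \<le> 1 \<longrightarrow> (AE \<omega> in M. \<bar>X \<omega> + r * Z \<omega> - V r \<omega>\<bar> \<le> r * \<bar>a \<omega>\<bar> + E r \<omega> \<and> 0 \<le> E r \<omega> \<and> E r \<omega> \<le> r * K)) \<and>
    (\<forall>e>0. \<forall>\<^sub>F r in at_right 0. (\<integral>\<^sup>+\<omega>. ennreal (E r \<omega>) \<partial>M) \<le> ennreal (r * e))"

text \<open>With \<open>W\<close> the centred shift and \<open>Y r\<close> the shifted variable plus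
  noise, \<open>V r\<close> is the rearrangement of \<open>Y r\<close>. The displacement from
  \<open>X + r * Z\<close> to \<open>V r\<close> then consists of \<open>r * h X\<close>, the noise,
  and the rearrangement cost; only the first is of exact order \<open>r\<close>.\<close>

lemma (in prob_space) corrected_coordinate:
  fixes X Z U :: "'a \<Rightarrow> real" and h :: "real \<Rightarrow> real"
  assumes [measurable]: "random_variable borel X" "random_variable borel Z" "random_variable borel U"
      "h \<in> borel_measurable borel"
    and ac: "absolutely_continuous lborel (distr M borel X)"
    and Z: "\<And>\<omega>. \<omega> \<in> space M \<Longrightarrow> \<bar>Z \<omega>\<bar> \<le> K" and h: "\<And>x. \<bar>h x\<bar> \<le> K"
    and U: "AE \<omega> in M. 0 \<le> U \<omega> \<and> U \<omega> \<le> 1"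
    and mean: "\<And>B. B \<in> sets borel \<Longrightarrow> (\<integral>\<omega>. (Z \<omega> - h (X \<omega>)) * indicator B (X \<omega>) \<partial>M) = 0"
    and atomless: "\<And>r t. 0 < r \<Longrightarrow> prob {\<omega>\<in>space M. X \<omega> + r * (Z \<omega> - h (X \<omega>)) + r\<^sup>2 * U \<omega> = t} = 0"
  obtains V E where "correction M (2 * K + 2) X Z (\<lambda>\<omega>. h (X \<omega>)) V E"
proof -
  define W where "W \<omega> = Z \<omega> - h (X \<omega>)" for \<omega>
  have [measurable]: "random_variable borel W" unfolding W_def[abs_def] by measurable
  define Y where "Y r \<omega> = X \<omega> + r * W \<omega> + r\<^sup>2 * U \<omega>" for r \<omega>
  have [measurable]: "random_variable borel (Y r)" for r unfolding Y_def[abs_def] by measurable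
  let ?p = "\<lambda>(Y :: 'a \<Rightarrow> real) t. prob {\<omega>\<in>space M. Y \<omega> \<le> t}"
  have W: "\<bar>W \<omega>\<bar> \<le> 2 * K" if "\<omega> \<in> space M" for \<omega>
    using Z[OF that] h[of "X \<omega>"] unfolding W_def by linarith
  \<comment> \<open>One predicate for all four properties lets a single choice provide
    \<open>T r\<close> for every positive \<open>r\<close>.\<close>
  define P where "P r T \<longleftrightarrow> T \<in> borel_measurable borel \<and> distr M borel (\<lambda>\<omega>. T (Y r \<omega>)) = distr M borel X \<and>
      (\<integral>\<^sup>+\<omega>. ennreal \<bar>T (Y r \<omega>) - Y r \<omega>\<bar> \<partial>M) = (\<integral>\<^sup>+t. ennreal \<bar>?p (Y r) t - ?p X t\<bar> \<partial>lborel) \<and>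
      (\<forall>c. (AE \<omega> in M. \<bar>X \<omega> - Y r \<omega>\<bar> \<le> c) \<longrightarrow> (AE \<omega> in M. \<bar>T (Y r \<omega>) - Y r \<omega>\<bar> \<le> c))" for r T
  have "\<exists>T. P r T" if r: "0 < r" for r
  proof -
    have "prob {\<omega>\<in>space M. Y r \<omega> = t} = 0" for t using atomless[OF r, of t] by (simp add: Y_def W_def)
    then show ?thesis
      unfolding P_def by (rule monotone_rearrangement[of X "Y r", rotated 2]) auto
  qed
  then obtain T where P: "\<And>r. 0 < r \<Longrightarrow> P r (T r)" by metis
  then have T: "\<And>r. 0 < r \<Longrightarrow> T r \<in> borel_measurable borel"
    and law: "\<And>r. 0 < r \<Longrightarrow> distr M borel (\<lambda>\<omega>. T r (Y r \<omega>)) = distr M borel X"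
    and cost: "\<And>r. 0 < r \<Longrightarrow> (\<integral>\<^sup>+\<omega>. ennreal \<bar>T r (Y r \<omega>) - Y r \<omega>\<bar> \<partial>M) = (\<integral>\<^sup>+t. ennreal \<bar>?p (Y r) t - ?p X t\<bar> \<partial>lborel)"
    and bd: "\<And>r c. 0 < r \<Longrightarrow> (AE \<omega> in M. \<bar>X \<omega> - Y r \<omega>\<bar> \<le> c) \<Longrightarrow> AE \<omega> in M. \<bar>T r (Y r \<omega>) - Y r \<omega>\<bar> \<le> c"
    by (simp_all add: P_def)
  define V where "V r \<omega> = T r (Y r \<omega>)" for r \<omega>
  \<comment> \<open>The square absorbs the noise term \<open>r\<^sup>2 * U \<omega>\<close> in the
    displacement.\<close>
  define E where "E r \<omega> = \<bar>V r \<omega> - Y r \<omega>\<bar> + r\<^sup>2" for r \<omega>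
  have V[measurable]: "random_variable borel (V r)" if "0 < r" for r
    unfolding V_def[abs_def] by (rule measurable_compose[OF _ T[OF that]]) simp
  have E[measurable]: "random_variable borel (E r)" if "0 < r" for r
    unfolding E_def[abs_def] using V[OF that] by measurable
  have "correction M (2 * K + 2) X Z (\<lambda>\<omega>. h (X \<omega>)) V E"
    unfolding correction_def
  proof (intro conjI allI impI)
    fix r :: real assume r: "0 < r"
    show "random_variable borel (V r)" "random_variable borel (E r)" by (rule V[OF r], rule E[OF r])
    show "distr M borel (V r) = distr M borel X" using law[OF r] by (simp add: V_def[abs_def])
  next
    fix r :: real assume r: "0 < r" and r1: "r \<le> 1"
    have rr: "r\<^sup>2 \<le> r" using r r1 by (simp add: power2_eq_square mult_left_le)
    \<comment> \<open>The rearrangement never moves further than the uniform distance from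
      \<open>X\<close> to \<open>Y r\<close>: \<open>2 * K\<close> bounds \<open>W\<close>, and the
      noise adds at most \<open>r\<^sup>2\<close>, which is at most \<open>r\<close>. The square
      inside \<open>E\<close> raises the constant to \<open>2 * K + 2\<close>.\<close>
    have "AE \<omega> in M. \<bar>V r \<omega> - Y r \<omega>\<bar> \<le> r * (2 * K + 1)"
      unfolding V_def
    proof (rule bd[OF r])
      show "AE \<omega> in M. \<bar>X \<omega> - Y r \<omega>\<bar> \<le> r * (2 * K + 1)"
        using U AE_space
      proof eventually_elim
        case (elim \<omega>)
        have "\<bar>r * W \<omega>\<bar> \<le> r * (2 * K)" using W[OF elim(2)] r by (simp add: abs_mult)
        moreover have "0 \<le> r\<^sup>2 * U \<omega>" "r\<^sup>2 * U \<omega> \<le> r\<^sup>2" using elim by (auto simp: mult_left_le)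
        ultimately show ?case using rr unfolding Y_def distrib_left by linarith
      qed
    qed
    then show "AE \<omega> in M. \<bar>X \<omega> + r * Z \<omega> - V r \<omega>\<bar> \<le> r * \<bar>h (X \<omega>)\<bar> + E r \<omega> \<and>
        0 \<le> E r \<omega> \<and> E r \<omega> \<le> r * (2 * K + 2)"
      using U
    proof eventually_elim
      case (elim \<omega>)
      have "0 \<le> r\<^sup>2 * U \<omega>" "r\<^sup>2 * U \<omega> \<le> r\<^sup>2" using elim by (auto simp: mult_left_le)
      moreover have "X \<omega> + r * Z \<omega> - V r \<omega> = r * h (X \<omega>) - r\<^sup>2 * U \<omega> - (V r \<omega> - Y r \<omega>)"
        by (simp add: Y_def W_def algebra_simps)
      moreover have "\<bar>r * h (X \<omega>)\<bar> = r * \<bar>h (X \<omega>)\<bar>" using r by (simp add: abs_mult)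
      ultimately have "\<bar>X \<omega> + r * Z \<omega> - V r \<omega>\<bar> \<le> r * \<bar>h (X \<omega>)\<bar> + E r \<omega>" unfolding E_def by linarith
      moreover have "E r \<omega> \<le> r * (2 * K + 2)" using elim rr by (simp add: E_def algebra_simps)
      ultimately show ?case by (simp add: E_def)
    qed
  next
    fix e :: real assume e: "0 < e"
    \<comment> \<open>One third of \<open>e\<close> pays for the shift by \<open>W\<close>; the
      other two pay for \<open>r * r\<close>, which occurs once as noise in \<open>Y r\<close> and
      once as the square in \<open>E\<close>.\<close>
    have "\<forall>\<^sub>F r in at_right 0. (\<integral>\<^sup>+t. ennreal \<bar>?p (\<lambda>\<omega>. X \<omega> + r * W \<omega>) t - ?p X t\<bar> \<partial>lborel) \<le> ennreal (r * (e / 3))"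
      using mean e by (intro W1_perturbation[OF _ _ ac W]) (auto simp: W_def)
    moreover have "\<forall>\<^sub>F r in at_right (0::real). r \<in> {0<..<e / 3}" using e by (intro eventually_at_right_real) simp
    ultimately show "\<forall>\<^sub>F r in at_right 0. (\<integral>\<^sup>+\<omega>. ennreal (E r \<omega>) \<partial>M) \<le> ennreal (r * e)"
    proof eventually_elim
      case (elim r)
      then have r: "0 < r" "r < e / 3" by auto
      have [measurable]: "random_variable borel Y \<Longrightarrow> (\<lambda>t. ?p Y t) \<in> borel_measurable borel" for Y
        by (intro borel_measurable_mono) (auto intro!: monoI finite_measure_mono)
      have "(\<integral>\<^sup>+t. ennreal \<bar>?p (Y r) t - ?p X t\<bar> \<partial>lborel)
          = (\<integral>\<^sup>+t. ennreal \<bar>(?p (Y r) t - ?p (\<lambda>\<omega>. X \<omega> + r * W \<omega>) t) + (?p (\<lambda>\<omega>. X \<omega> + r * W \<omega>) t - ?p X t)\<bar> \<partial>lborel)"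
        by simp
      also have "\<dots> \<le> (\<integral>\<^sup>+t. ennreal \<bar>?p (Y r) t - ?p (\<lambda>\<omega>. X \<omega> + r * W \<omega>) t\<bar> \<partial>lborel)
          + (\<integral>\<^sup>+t. ennreal \<bar>?p (\<lambda>\<omega>. X \<omega> + r * W \<omega>) t - ?p X t\<bar> \<partial>lborel)"
        by (rule nn_integral_abs_add_le) measurable
      also have "\<dots> \<le> (\<integral>\<^sup>+\<omega>. ennreal \<bar>Y r \<omega> - (X \<omega> + r * W \<omega>)\<bar> \<partial>M) + ennreal (r * (e / 3))"
        using elim by (intro add_mono nn_integral_cdf_diff_le) auto
      also have "(\<integral>\<^sup>+\<omega>. ennreal \<bar>Y r \<omega> - (X \<omega> + r * W \<omega>)\<bar> \<partial>M) \<le> (\<integral>\<^sup>+\<omega>. ennreal (r * r) \<partial>M)"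
      proof (rule nn_integral_mono_AE)
        show "AE \<omega> in M. ennreal \<bar>Y r \<omega> - (X \<omega> + r * W \<omega>)\<bar> \<le> ennreal (r * r)"
          using U by eventually_elim (simp add: Y_def mult_left_le power2_eq_square ennreal_leI)
      qed
      finally have "(\<integral>\<^sup>+\<omega>. ennreal \<bar>V r \<omega> - Y r \<omega>\<bar> \<partial>M) \<le> ennreal (r * r) + ennreal (r * (e / 3))"
        by (simp add: cost[OF r(1)] V_def emeasure_space_1 add_right_mono)
      then have *: "(\<integral>\<^sup>+\<omega>. ennreal \<bar>V r \<omega> - Y r \<omega>\<bar> \<partial>M) \<le> ennreal (r * r + r * (e / 3))"
        using r e by (simp add: ennreal_plus)
      have "(\<integral>\<^sup>+\<omega>. ennreal (E r \<omega>) \<partial>M) = (\<integral>\<^sup>+\<omega>. ennreal \<bar>V r \<omega> - Y r \<omega>\<bar> + ennreal (r * r) \<partial>M)"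
        by (simp add: E_def power2_eq_square)
      also have "\<dots> = (\<integral>\<^sup>+\<omega>. ennreal \<bar>V r \<omega> - Y r \<omega>\<bar> \<partial>M) + ennreal (r * r)"
        using V[OF r(1)] by (subst nn_integral_add) (auto simp: emeasure_space_1)
      also have "\<dots> \<le> ennreal (r * r + r * (e / 3)) + ennreal (r * r)" using * by (rule add_right_mono)
      also have "\<dots> = ennreal (r * (r + e / 3 + r))" using r e by (simp add: ennreal_plus[symmetric] algebra_simps del: ennreal_plus)
      also have "\<dots> \<le> ennreal (r * e)" using r by (intro ennreal_leI mult_left_mono) auto
      finally show ?case .
    qed
  qed
  then show ?thesis by (rule that)
qed

subsection \<open>Transport cost\<close>

lemma ennreal_powr_mono:
  assumes "x \<le> y" "0 \<le> a"
  shows "ennreal_powr x a \<le> ennreal_powr y a"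
proof (cases "y = \<infinity>")
  case False
  moreover then have "x \<noteq> \<infinity>" using assms(1) by (auto simp: top_unique)
  ultimately show ?thesis using assms
    by (auto simp: ennreal_powr_def intro!: ennreal_leI powr_mono2 enn2real_mono simp: less_top)
qed (simp add: ennreal_powr_def)

text \<open>The sum is at most four times its largest term. This is the origin of the constant 4 in
  the theorem.\<close>

lemma powr_sum4_le:
  fixes x y u v p :: real
  assumes "0 \<le> x" "0 \<le> y" "0 \<le> u" "0 \<le> v" "0 < p"
  shows "(x + y + u + v) powr p \<le> 4 powr p * (x powr p + y powr p + u powr p + v powr p)"
proof -
  define m where "m = Max {x, y, u, v}"
  have m: "x \<le> m" "y \<le> m" "u \<le> m" "v \<le> m" by (auto simp: m_def)
  have "m \<in> {x, y, u, v}" unfolding m_def by (rule Max_in) auto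
  then have mp: "m powr p \<le> x powr p + y powr p + u powr p + v powr p" by auto
  have "(x + y + u + v) powr p \<le> (4 * m) powr p" using assms m by (intro powr_mono2) auto
  also have "\<dots> = 4 powr p * m powr p" by (rule powr_mult)
  also have "\<dots> \<le> 4 powr p * (x powr p + y powr p + u powr p + v powr p)" using mp by (intro mult_left_mono) auto
  finally show ?thesis .
qed

text \<open>The displacement is bounded by four terms, two proportional to \<open>r\<close> and two
  errors. Interpolating each error between its uniform bound and its mean makes its p-th moment at
  most r^p K^(p-1) e, so a common factor r^p can be pulled out of the cost.\<close>

lemma (in prob_space) transport_cost_le:
  fixes P V :: "'a \<Rightarrow> real \<times> real" and a1 a2 E1 E2 :: "'a \<Rightarrow> real"
  assumes p: "1 < p" and r: "0 < r" and K: "0 \<le> K" and e: "0 \<le> e"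
    and [measurable]: "random_variable borel a1" "random_variable borel a2"
      "random_variable borel E1" "random_variable borel E2"
    and 1: "AE \<omega> in M. \<bar>fst (P \<omega>) - fst (V \<omega>)\<bar> \<le> r * \<bar>a1 \<omega>\<bar> + E1 \<omega> \<and> 0 \<le> E1 \<omega> \<and> E1 \<omega> \<le> r * K"
    and 2: "AE \<omega> in M. \<bar>snd (P \<omega>) - snd (V \<omega>)\<bar> \<le> r * \<bar>a2 \<omega>\<bar> + E2 \<omega> \<and> 0 \<le> E2 \<omega> \<and> E2 \<omega> \<le> r * K"
    and c1: "(\<integral>\<^sup>+\<omega>. ennreal (\<bar>a1 \<omega>\<bar> powr p) \<partial>M) = ennreal c1" "0 \<le> c1"
    and c2: "(\<integral>\<^sup>+\<omega>. ennreal (\<bar>a2 \<omega>\<bar> powr p) \<partial>M) = ennreal c2" "0 \<le> c2"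
    and E: "(\<integral>\<^sup>+\<omega>. ennreal (E1 \<omega>) \<partial>M) \<le> ennreal (r * e)" "(\<integral>\<^sup>+\<omega>. ennreal (E2 \<omega>) \<partial>M) \<le> ennreal (r * e)"
  shows "ennreal_powr (\<integral>\<^sup>+\<omega>. ennreal (norm (P \<omega> - V \<omega>) powr p) \<partial>M) (1 / p)
    \<le> ennreal (r * (4 * (c1 + c2 + 2 * K powr (p - 1) * e) powr (1 / p)))"
proof -
  define k where "k = K powr (p - 1)"
  have k: "0 \<le> k" by (simp add: k_def)
  \<comment> \<open>After scaling by \<open>r\<close>, all but one factor of the power is estimated
    by \<open>K\<close>; the remaining linear factor is what the mean controls.\<close>
  have Epow: "x powr p \<le> r powr p * k * (x / r)" if "0 \<le> x" "x \<le> r * K" for x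
  proof -
    have xr: "0 \<le> x / r" "x / r \<le> K" using that r by (auto simp: field_simps)
    have "x powr p = r powr p * (x / r) powr p" using that r by (simp add: powr_divide)
    also have "(x / r) powr p = (x / r) powr (p - 1) * (x / r)"
      using powr_add[of "x / r" "p - 1" 1] xr that r by simp
    also have "\<dots> \<le> k * (x / r)" unfolding k_def using xr p by (intro mult_right_mono powr_mono2) auto
    finally show ?thesis using r by (simp add: mult.assoc mult_left_mono)
  qed
  define l where "l = k / r"
  have l: "0 \<le> l" using k r by (simp add: l_def)
  define C where "C = 4 powr p * r powr p"
  have C: "0 \<le> C" by (simp add: C_def)
  have "(\<integral>\<^sup>+\<omega>. ennreal (norm (P \<omega> - V \<omega>) powr p) \<partial>M)
      \<le> (\<integral>\<^sup>+\<omega>. ennreal C * (ennreal (\<bar>a1 \<omega>\<bar> powr p) + ennreal (\<bar>a2 \<omega>\<bar> powr p)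
          + ennreal l * ennreal (E1 \<omega>) + ennreal l * ennreal (E2 \<omega>)) \<partial>M)"
  proof (rule nn_integral_mono_AE)
    show "AE \<omega> in M. ennreal (norm (P \<omega> - V \<omega>) powr p) \<le> ennreal C * (ennreal (\<bar>a1 \<omega>\<bar> powr p) + ennreal (\<bar>a2 \<omega>\<bar> powr p)
          + ennreal l * ennreal (E1 \<omega>) + ennreal l * ennreal (E2 \<omega>))"
      using 1 2
    proof eventually_elim
      case (elim \<omega>)
      let ?x = "r * \<bar>a1 \<omega>\<bar>" and ?y = "r * \<bar>a2 \<omega>\<bar>" and ?u = "E1 \<omega>" and ?v = "E2 \<omega>"
      have "norm (P \<omega> - V \<omega>) \<le> \<bar>fst (P \<omega>) - fst (V \<omega>)\<bar> + \<bar>snd (P \<omega>) - snd (V \<omega>)\<bar>"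
        using sqrt_sum_squares_le_sum_abs[of "fst (P \<omega>) - fst (V \<omega>)" "snd (P \<omega>) - snd (V \<omega>)"]
        by (simp add: norm_prod_def)
      also have "\<dots> \<le> ?x + ?y + ?u + ?v" using elim by linarith
      finally have "norm (P \<omega> - V \<omega>) powr p \<le> (?x + ?y + ?u + ?v) powr p" using p by (intro powr_mono2) auto
      also have "\<dots> \<le> 4 powr p * (?x powr p + ?y powr p + ?u powr p + ?v powr p)"
        using elim r p by (intro powr_sum4_le) auto
      also have "\<dots> \<le> 4 powr p * (r powr p * \<bar>a1 \<omega>\<bar> powr p + r powr p * \<bar>a2 \<omega>\<bar> powr p
          + r powr p * k * (?u / r) + r powr p * k * (?v / r))"
        using elim r by (intro mult_left_mono add_mono Epow) (auto simp: powr_mult)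
      also have "\<dots> = C * (\<bar>a1 \<omega>\<bar> powr p + \<bar>a2 \<omega>\<bar> powr p + l * ?u + l * ?v)"
        by (simp add: C_def l_def algebra_simps)
      finally have "ennreal (norm (P \<omega> - V \<omega>) powr p) \<le> ennreal (C * (\<bar>a1 \<omega>\<bar> powr p + \<bar>a2 \<omega>\<bar> powr p + l * ?u + l * ?v))"
        by (rule ennreal_leI)
      also have "\<dots> = ennreal C * (ennreal (\<bar>a1 \<omega>\<bar> powr p) + ennreal (\<bar>a2 \<omega>\<bar> powr p)
          + ennreal l * ennreal ?u + ennreal l * ennreal ?v)"
        using elim l C by (simp add: ennreal_mult ennreal_plus)
      finally show ?case .
    qed
  qed
  also have "\<dots> = ennreal C * ((\<integral>\<^sup>+\<omega>. ennreal (\<bar>a1 \<omega>\<bar> powr p) \<partial>M) + (\<integral>\<^sup>+\<omega>. ennreal (\<bar>a2 \<omega>\<bar> powr p) \<partial>M)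
          + ennreal l * (\<integral>\<^sup>+\<omega>. ennreal (E1 \<omega>) \<partial>M) + ennreal l * (\<integral>\<^sup>+\<omega>. ennreal (E2 \<omega>) \<partial>M))"
    by (simp add: nn_integral_cmult nn_integral_add)
  also have "\<dots> \<le> ennreal C * (ennreal c1 + ennreal c2 + ennreal l * ennreal (r * e) + ennreal l * ennreal (r * e))"
    using c1 c2 E by (intro mult_left_mono add_mono) auto
  also have "\<dots> = ennreal (C * (c1 + c2 + l * (r * e) + l * (r * e)))"
    using c1 c2 C l r e by (simp only: ennreal_mult ennreal_plus add_nonneg_nonneg mult_nonneg_nonneg less_imp_le)
  also have "C * (c1 + c2 + l * (r * e) + l * (r * e)) = C * (c1 + c2 + 2 * k * e)"
    using r by (simp add: l_def field_simps)
  finally have "ennreal_powr (\<integral>\<^sup>+\<omega>. ennreal (norm (P \<omega> - V \<omega>) powr p) \<partial>M) (1 / p)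
      \<le> ennreal_powr (ennreal (C * (c1 + c2 + 2 * k * e))) (1 / p)"
    using p by (intro ennreal_powr_mono) auto
  also have "\<dots> = ennreal ((C * (c1 + c2 + 2 * k * e)) powr (1 / p))"
    using C c1 c2 k e by (simp add: ennreal_powr_def)
  also have "(C * (c1 + c2 + 2 * k * e)) powr (1 / p) = r * (4 * (c1 + c2 + 2 * k * e) powr (1 / p))"
    using c1 c2 k e r p by (simp add: C_def powr_mult powr_powr)
  finally show ?thesis by (simp add: k_def)
qed

text \<open>Scaled to sum 1, each term is at most its own root. It splits the joint norm into the
  two marginal norms without a further constant.\<close>

lemma powr_inverse_add_le:
  fixes a b p :: real
  assumes "0 \<le> a" "0 \<le> b" "1 \<le> p"
  shows "(a + b) powr (1 / p) \<le> a powr (1 / p) + b powr (1 / p)"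
proof (cases "a + b = 0")
  case False
  then have s: "0 < a + b" using assms by auto
  have *: "x / (a + b) \<le> (x / (a + b)) powr (1 / p)" if "0 \<le> x" "x \<le> a + b" for x
    using powr_mono'[of "1 / p" 1 "x / (a + b)"] that s assms by (auto simp: divide_le_eq_1)
  have "1 = a / (a + b) + b / (a + b)" using s by (simp add: add_divide_distrib[symmetric])
  also have "\<dots> \<le> (a / (a + b)) powr (1 / p) + (b / (a + b)) powr (1 / p)"
    using assms by (intro add_mono *) auto
  also have "\<dots> = (a powr (1 / p) + b powr (1 / p)) / (a + b) powr (1 / p)"
    using assms s by (simp add: powr_divide add_divide_distrib)
  finally show ?thesis using s by (simp add: le_divide_eq)
qed (use assms in auto)

text \<open>The tolerance \<open>e\<close> is held fixed while \<open>r\<close> tends to 0, because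
  how small \<open>r\<close> must be depends on \<open>e\<close>; only afterwards does
  \<open>e\<close> tend to 0 in the resulting bound.\<close>

lemma (in prob_space) Limsup_transport_cost_le:
  fixes a1 a2 :: "'a \<Rightarrow> real" and D :: "real \<Rightarrow> ennreal"
  assumes p: "1 < p" and K: "0 \<le> K"
    and c: "correction M K X1 Z1 a1 V1 E1" "correction M K X2 Z2 a2 V2 E2"
    and m: "random_variable borel a1" "random_variable borel a2"
    and a: "\<And>\<omega>. \<bar>a1 \<omega>\<bar> \<le> K" "\<And>\<omega>. \<bar>a2 \<omega>\<bar> \<le> K"
    and D: "\<And>r. 0 < r \<Longrightarrow> r \<le> 1 \<Longrightarrow> D r \<le> ennreal_powr (\<integral>\<^sup>+\<omega>. ennreal (norm
        ((X1 \<omega> + r * Z1 \<omega>, X2 \<omega> + r * Z2 \<omega>) - (V1 r \<omega>, V2 r \<omega>)) powr p) \<partial>M) (1 / p)"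
  shows "Limsup (at_right 0) (\<lambda>r. ennreal (1 / r) * D r) \<le> ennreal 4 * (lp_norm p M a1 + lp_norm p M a2)"
proof -
  have fin: "\<exists>c\<ge>0. (\<integral>\<^sup>+\<omega>. ennreal (\<bar>f \<omega>\<bar> powr p) \<partial>M) = ennreal c"
    if f: "\<And>\<omega>. \<bar>f \<omega>\<bar> \<le> K" for f :: "'a \<Rightarrow> real"
  proof -
    have "(\<integral>\<^sup>+\<omega>. ennreal (\<bar>f \<omega>\<bar> powr p) \<partial>M) \<le> (\<integral>\<^sup>+\<omega>. ennreal (K powr p) \<partial>M)"
      using f p by (intro nn_integral_mono ennreal_leI powr_mono2) auto
    also have "\<dots> < \<infinity>" by (simp add: emeasure_space_1)
    finally show ?thesis by (intro exI[of _ "enn2real (\<integral>\<^sup>+\<omega>. ennreal (\<bar>f \<omega>\<bar> powr p) \<partial>M)"]) simp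
  qed
  obtain c1 where c1: "(\<integral>\<^sup>+\<omega>. ennreal (\<bar>a1 \<omega>\<bar> powr p) \<partial>M) = ennreal c1" "0 \<le> c1" using fin[of a1, OF a(1)] by auto
  obtain c2 where c2: "(\<integral>\<^sup>+\<omega>. ennreal (\<bar>a2 \<omega>\<bar> powr p) \<partial>M) = ennreal c2" "0 \<le> c2" using fin[of a2, OF a(2)] by auto
  define L where "L = Limsup (at_right 0) (\<lambda>r. ennreal (1 / r) * D r)"
  define f where "f e = ennreal (4 * (c1 + c2 + 2 * K powr (p - 1) * e) powr (1 / p))" for e
  have "L \<le> f e" if e: "0 < e" for e
    unfolding L_def
  proof (rule Limsup_bounded)
    have "\<forall>\<^sub>F r in at_right (0::real). r \<in> {0<..<1}" by (intro eventually_at_right_real) simp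
    moreover have "\<forall>\<^sub>F r in at_right 0. (\<integral>\<^sup>+\<omega>. ennreal (E1 r \<omega>) \<partial>M) \<le> ennreal (r * e)"
        "\<forall>\<^sub>F r in at_right 0. (\<integral>\<^sup>+\<omega>. ennreal (E2 r \<omega>) \<partial>M) \<le> ennreal (r * e)"
      using c e by (simp_all add: correction_def)
    ultimately show "\<forall>\<^sub>F r in at_right 0. ennreal (1 / r) * D r \<le> f e"
    proof eventually_elim
      case (elim r)
      then have r: "0 < r" "r \<le> 1" by auto
      have "D r \<le> ennreal (r * (4 * (c1 + c2 + 2 * K powr (p - 1) * e) powr (1 / p)))"
        using c e r elim p K m c1 c2
        by (intro order_trans[OF D[OF r] transport_cost_le[where ?a1.0=a1 and ?a2.0=a2 and ?E1.0="E1 r" and ?E2.0="E2 r"]])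
          (simp_all add: correction_def)
      then have "ennreal (1 / r) * D r \<le> ennreal (1 / r) * ennreal (r * (4 * (c1 + c2 + 2 * K powr (p - 1) * e) powr (1 / p)))"
        by (rule mult_left_mono) simp
      also have "\<dots> = f e" using r by (simp add: f_def ennreal_mult'[symmetric])
      finally show ?case .
    qed
  qed
  then have "\<forall>\<^sub>F e in at_right 0. L \<le> f e" by (auto intro: eventually_mono[OF eventually_at_right_less])
  \<comment> \<open>The limit \<open>c1 + c2\<close> of the base may be 0, for instance when both
    conditional means vanish. Convergence of the power then rests on a positive exponent and a base
    that is eventually nonnegative.\<close>
  moreover have "(f \<longlongrightarrow> ennreal (4 * (c1 + c2 + 2 * K powr (p - 1) * 0) powr (1 / p))) (at_right 0)"
    unfolding f_def
  proof (intro tendsto_ennrealI tendsto_mult tendsto_const tendsto_powr' tendsto_add tendsto_ident_at disjI2 conjI)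
    show "\<forall>\<^sub>F e in at_right 0. 0 \<le> c1 + c2 + 2 * K powr (p - 1) * e"
      using c1 c2 by (intro eventually_mono[OF eventually_at_right_less]) auto
  qed (use p in auto)
  ultimately have "L \<le> ennreal (4 * (c1 + c2 + 2 * K powr (p - 1) * 0) powr (1 / p))"
    by (intro tendsto_lowerbound) auto
  also have "\<dots> \<le> ennreal (4 * (c1 powr (1 / p) + c2 powr (1 / p)))"
    using powr_inverse_add_le[of c1 c2 p] c1 c2 p by (intro ennreal_leI) auto
  also have "\<dots> = ennreal 4 * (lp_norm p M a1 + lp_norm p M a2)"
    using c1 c2 by (simp add: lp_norm_def ennreal_powr_def ennreal_mult ennreal_plus)
  finally show ?thesis unfolding L_def .
qed

subsection \<open>Perturbations of measures on the plane\<close>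

text \<open>The chosen version of the conditional expectation is arbitrary on null sets, so it
  inherits the bound \<open>K\<close> only almost surely. Clamping it to the interval from
  \<open>- K\<close> to \<open>K\<close> gives a bound at every point and changes it only on a null
  set.\<close>

lemma cond_exp_given_clamped:
  fixes \<mu> :: "(real \<times> real) measure" and f :: "real \<times> real \<Rightarrow> real"
  assumes \<mu>: "borel_prob \<mu>" and Y: "Y = fst \<or> Y = snd"
    and f[measurable]: "f \<in> borel_measurable borel" and K: "\<And>x. \<bar>f x\<bar> \<le> K"
  obtains h where "h \<in> borel_measurable borel" "\<And>t. \<bar>h t\<bar> \<le> K"
    "AE x in \<mu>. cond_exp_given \<mu> Y f (Y x) = h (Y x)"
    "\<And>B. B \<in> sets borel \<Longrightarrow> (\<integral>x. (f x - h (Y x)) * indicator B (Y x) \<partial>\<mu>) = 0"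
proof -
  interpret prob_space \<mu> using \<mu> by (simp add: borel_prob_def)
  have s[measurable_cong]: "sets \<mu> = sets borel" using \<mu> by (simp add: borel_prob_def)
  have [measurable]: "Y \<in> borel_measurable borel"
    using Y unfolding borel_prod[symmetric] by auto
  define c where "c = cond_exp_given \<mu> Y f"
  have c[measurable]: "c \<in> borel_measurable borel"
    and ce: "AE x in \<mu>. real_cond_exp \<mu> (sigma_of \<mu> Y) f x = c (Y x)"
    using cond_exp_given_coordinate[OF \<mu> Y, of f] by (auto simp: c_def)
  have sub: "subalgebra \<mu> (sigma_of \<mu> Y)"
    unfolding subalgebra_def sigma_of_def by (auto simp: sets_vimage_algebra2 intro!: measurable_sets)
  interpret finite_measure_subalgebra \<mu> "sigma_of \<mu> Y" by unfold_locales (rule sub)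
  have K0: "0 \<le> K" using K[of undefined] by linarith
  have int_f: "integrable \<mu> f" using K by (intro integrable_const_bound[of _ K]) auto
  define h where "h t = max (- K) (min K (c t))" for t
  have h[measurable]: "h \<in> borel_measurable borel" unfolding h_def[abs_def] by measurable
  have hK: "\<bar>h t\<bar> \<le> K" for t using K0 by (auto simp: h_def)
  have "AE x in \<mu>. - K \<le> real_cond_exp \<mu> (sigma_of \<mu> Y) f x" "AE x in \<mu>. real_cond_exp \<mu> (sigma_of \<mu> Y) f x \<le> K"
    using K by (intro real_cond_exp_ge_c real_cond_exp_le_c int_f AE_I2; simp add: abs_le_iff minus_le_iff)+
  with ce have ch: "AE x in \<mu>. c (Y x) = h (Y x)"
    by eventually_elim (auto simp: h_def)
  show ?thesis
  proof
    show "AE x in \<mu>. cond_exp_given \<mu> Y f (Y x) = h (Y x)" using ch by (simp add: c_def)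
    fix B :: "real set" assume [measurable]: "B \<in> sets borel"
    let ?A = "Y -` B \<inter> space \<mu>"
    have A: "?A \<in> sets (sigma_of \<mu> Y)"
      unfolding sigma_of_def by (subst sets_vimage_algebra2) auto
    have i: "integrable \<mu> (\<lambda>x. f x * indicator B (Y x))" "integrable \<mu> (\<lambda>x. h (Y x) * indicator B (Y x))"
      using K hK K0 by (auto intro!: integrable_const_bound[of _ K] simp: indicator_def)
    have "(\<integral>x. f x * indicator B (Y x) \<partial>\<mu>) = (\<integral>x\<in>?A. f x \<partial>\<mu>)"
      unfolding set_lebesgue_integral_def by (intro Bochner_Integration.integral_cong) (auto simp: indicator_def)
    also have "\<dots> = (\<integral>x\<in>?A. real_cond_exp \<mu> (sigma_of \<mu> Y) f x \<partial>\<mu>)" by (rule real_cond_exp_intA[OF int_f A])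
    also have "\<dots> = (\<integral>x. h (Y x) * indicator B (Y x) \<partial>\<mu>)"
      unfolding set_lebesgue_integral_def
    proof (rule integral_cong_AE)
      show "AE x in \<mu>. indicat_real ?A x *\<^sub>R real_cond_exp \<mu> (sigma_of \<mu> Y) f x = h (Y x) * indicator B (Y x)"
        using ce ch AE_space by eventually_elim (auto simp: indicator_def)
    qed measurable
    finally show "(\<integral>x. (f x - h (Y x)) * indicator B (Y x) \<partial>\<mu>) = 0"
      using i by (simp add: left_diff_distrib)
  qed (auto simp: hK)
qed

abbreviation unit_uniform :: "real measure" where
  "unit_uniform \<equiv> uniform_measure lborel {0..1}"

lemma prob_space_unit_uniform: "prob_space unit_uniform"
  by (rule prob_space_uniform_measure) auto

text \<open>The extra uniform variable makes the perturbed coordinate atomless, so that it can be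
  transported by a map.\<close>

lemma coordinate_correction:
  fixes \<mu> :: "(real \<times> real) measure" and f :: "real \<times> real \<Rightarrow> real"
  defines "N \<equiv> \<mu> \<Otimes>\<^sub>M unit_uniform"
  assumes \<mu>: "borel_prob \<mu>" and Y: "Y = fst \<or> Y = snd"
    and f[measurable]: "f \<in> borel_measurable borel" and K: "\<And>x. \<bar>f x\<bar> \<le> K"
    and ac: "absolutely_continuous lborel (distr \<mu> borel Y)"
  obtains h V E where
    "h \<in> borel_measurable borel" "\<forall>t. \<bar>h t\<bar> \<le> K"
    "lp_norm p N (\<lambda>\<omega>. h (Y (fst \<omega>))) = lp_norm p (distr \<mu> borel Y) (cond_exp_given \<mu> Y f)"
    "correction N (2 * K + 2) (\<lambda>\<omega>. Y (fst \<omega>)) (\<lambda>\<omega>. f (fst \<omega>)) (\<lambda>\<omega>. h (Y (fst \<omega>))) V E"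
proof -
  interpret M: prob_space \<mu> using \<mu> by (simp add: borel_prob_def)
  interpret U: prob_space unit_uniform by (rule prob_space_unit_uniform)
  interpret MU: pair_prob_space \<mu> unit_uniform ..
  interpret N: prob_space N unfolding N_def by (rule MU.prob_space_axioms)
  have s[measurable_cong]: "sets \<mu> = sets borel" using \<mu> by (simp add: borel_prob_def)
  have [measurable]: "Y \<in> borel_measurable borel"
    using Y unfolding borel_prod[symmetric] by auto
  have fstN[measurable]: "fst \<in> measurable N \<mu>" "snd \<in> borel_measurable N" by (simp_all add: N_def)
  have compN: "(\<lambda>\<omega>. Y (fst \<omega>)) \<in> borel_measurable N" "(\<lambda>\<omega>. f (fst \<omega>)) \<in> borel_measurable N"
    by (rule measurable_compose[OF fstN(1)]; simp)+
  have law: "distr N \<mu> fst = \<mu>" unfolding N_def by (rule U.distr_pair_fst)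
  obtain h where h[measurable]: "h \<in> borel_measurable borel" and hK: "\<And>t. \<bar>h t\<bar> \<le> K"
    and ch: "AE x in \<mu>. cond_exp_given \<mu> Y f (Y x) = h (Y x)"
    and mean: "\<And>B. B \<in> sets borel \<Longrightarrow> (\<integral>x. (f x - h (Y x)) * indicator B (Y x) \<partial>\<mu>) = 0"
    using cond_exp_given_clamped[OF \<mu> Y f K] by blast
  have hN: "(\<lambda>\<omega>. h (Y (fst \<omega>))) \<in> borel_measurable N" by (rule measurable_compose[OF compN(1) h])
  have c[measurable]: "cond_exp_given \<mu> Y f \<in> borel_measurable borel"
    using cond_exp_given_coordinate[OF \<mu> Y, of f] by auto
  have YN: "distr N borel (\<lambda>\<omega>. Y (fst \<omega>)) = distr \<mu> borel Y"
    by (subst law[symmetric], subst distr_distr) (auto simp: comp_def)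
  have norm: "lp_norm p N (\<lambda>\<omega>. h (Y (fst \<omega>))) = lp_norm p (distr \<mu> borel Y) (cond_exp_given \<mu> Y f)"
  proof -
    have "(\<integral>\<^sup>+\<omega>. ennreal (\<bar>h (Y (fst \<omega>))\<bar> powr p) \<partial>N) = (\<integral>\<^sup>+x. ennreal (\<bar>h (Y x)\<bar> powr p) \<partial>distr N \<mu> fst)"
      by (subst nn_integral_distr) auto
    also have "\<dots> = (\<integral>\<^sup>+x. ennreal (\<bar>cond_exp_given \<mu> Y f (Y x)\<bar> powr p) \<partial>\<mu>)"
      unfolding law using ch by (intro nn_integral_cong_AE) (auto elim!: eventually_mono)
    also have "\<dots> = (\<integral>\<^sup>+t. ennreal (\<bar>cond_exp_given \<mu> Y f t\<bar> powr p) \<partial>distr \<mu> borel Y)"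
      by (subst nn_integral_distr) auto
    finally show ?thesis by (simp add: lp_norm_def)
  qed
  have U01: "AE \<omega> in N. 0 \<le> snd \<omega> \<and> snd \<omega> \<le> 1"
  proof -
    have S: "{\<omega>\<in>space N. 0 \<le> snd \<omega> \<and> snd \<omega> \<le> 1} \<in> sets N" by measurable
    show ?thesis
      unfolding N_def
    proof (rule MU.AE_pair_measure)
    show "AE x in \<mu>. AE u in unit_uniform. 0 \<le> snd (x, u) \<and> snd (x, u) \<le> 1"
      by (rule AE_I2, rule AE_uniform_measureI) auto
    qed (use S[unfolded N_def] in simp)
  qed
  have meanN: "(\<integral>\<omega>. (f (fst \<omega>) - h (Y (fst \<omega>))) * indicator B (Y (fst \<omega>)) \<partial>N) = 0"
    if [measurable]: "B \<in> sets borel" for B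
  proof -
    have "(\<integral>\<omega>. (f (fst \<omega>) - h (Y (fst \<omega>))) * indicator B (Y (fst \<omega>)) \<partial>N)
        = (\<integral>x. (f x - h (Y x)) * indicator B (Y x) \<partial>distr N \<mu> fst)"
      by (subst integral_distr) auto
    then show ?thesis unfolding law using mean[OF that] by simp
  qed
  have atomless: "N.prob {\<omega>\<in>space N. Y (fst \<omega>) + r * (f (fst \<omega>) - h (Y (fst \<omega>))) + r\<^sup>2 * snd \<omega> = t} = 0"
    if r: "0 < r" for r t
  proof -
    let ?S = "{\<omega>\<in>space N. Y (fst \<omega>) + r * (f (fst \<omega>) - h (Y (fst \<omega>))) + r\<^sup>2 * snd \<omega> = t}"
    have g: "(\<lambda>\<omega>. Y (fst \<omega>) + r * (f (fst \<omega>) - h (Y (fst \<omega>))) + r\<^sup>2 * snd \<omega>) \<in> borel_measurable N"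
      by (intro borel_measurable_add borel_measurable_times borel_measurable_diff borel_measurable_const
          compN hN fstN(2))
    have S: "?S \<in> sets N"
    proof -
      have eq: "?S = (\<lambda>\<omega>. Y (fst \<omega>) + r * (f (fst \<omega>) - h (Y (fst \<omega>))) + r\<^sup>2 * snd \<omega>) -` {t} \<inter> space N"
        by blast
      have "{t} \<in> sets borel" by simp
      from measurable_sets[OF g this] show ?thesis unfolding eq .
    qed
    have "emeasure N ?S = (\<integral>\<^sup>+x. emeasure unit_uniform (Pair x -` ?S) \<partial>\<mu>)"
      using S unfolding N_def by (rule U.emeasure_pair_measure_alt)
    also have "\<dots> = (\<integral>\<^sup>+x. 0 \<partial>\<mu>)"
    proof (intro nn_integral_cong)
      fix x
      \<comment> \<open>For fixed \<open>x\<close> the equation is affine in the noise with nonzero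
        slope, so \<open>v\<close> is its only solution, and a single point is null for the uniform
        law.\<close>
      define v where "v = (t - Y x - r * (f x - h (Y x))) / r\<^sup>2"
      have sub: "Pair x -` ?S \<subseteq> {v}" using r by (auto simp: v_def field_simps)
      have "emeasure unit_uniform {v} = 0" by (subst emeasure_uniform_measure) (auto intro: emeasure_lborel_countable)
      then show "emeasure unit_uniform (Pair x -` ?S) = 0"
        using emeasure_mono[OF sub, of unit_uniform] by simp
    qed
    finally show ?thesis by (simp add: measure_def)
  qed
  have acN: "absolutely_continuous lborel (distr N borel (\<lambda>\<omega>. Y (fst \<omega>)))" using ac YN by simp
  show ?thesis
  proof (rule N.corrected_coordinate[OF compN fstN(2) h acN K hK U01 meanN atomless])
    fix V E
    assume "correction N (2 * K + 2) (\<lambda>\<omega>. Y (fst \<omega>)) (\<lambda>\<omega>. f (fst \<omega>)) (\<lambda>\<omega>. h (Y (fst \<omega>))) V E"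
    then show ?thesis using that[OF h _ norm] hK by blast
  qed
qed

text \<open>A cylinder over a null set is null for the product measure, even when the other factor
  is infinite. General factors cover both a density on the plane and a disintegration over a first
  marginal that may be singular.\<close>

lemma absolutely_continuous_marginals:
  fixes A B :: "real measure"
  assumes "sigma_finite_measure A" "sigma_finite_measure B"
    and sets[measurable_cong]: "sets A = sets borel" "sets B = sets borel"
    and k: "k \<in> borel_measurable borel" and \<mu>: "\<mu> = density (A \<Otimes>\<^sub>M B) k"
  shows "absolutely_continuous A (marg1 \<mu>)" "absolutely_continuous B (marg2 \<mu>)"
proof -
  interpret A: sigma_finite_measure A by fact
  interpret B: sigma_finite_measure B by fact
  interpret pair_sigma_finite A B by unfold_locales
  have sp: "space A = UNIV" "space B = UNIV" using sets_eq_imp_space_eq[OF sets(1)] sets_eq_imp_space_eq[OF sets(2)] by simp_all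
  have "sets (A \<Otimes>\<^sub>M B) = sets borel" using sets_pair_measure_cong[OF sets] by (simp only: borel_prod)
  then have [measurable]: "k \<in> borel_measurable (A \<Otimes>\<^sub>M B)"
    using k measurable_cong_sets[of "A \<Otimes>\<^sub>M B" borel] by blast
  have ac: "absolutely_continuous (A \<Otimes>\<^sub>M B) \<mu>"
    unfolding \<mu> by (rule absolutely_continuousI_density) measurable
  have [measurable_cong]: "sets \<mu> = sets (A \<Otimes>\<^sub>M B)" by (simp add: \<mu>)
  have sp\<mu>: "space \<mu> = UNIV" by (simp add: \<mu> space_pair_measure sp)
  have m: "fst \<in> borel_measurable \<mu>" "snd \<in> borel_measurable \<mu>" by measurable
  show "absolutely_continuous A (marg1 \<mu>)"
    unfolding absolutely_continuous_def
  proof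
    fix S assume S: "S \<in> null_sets A"
    then have S': "S \<in> sets borel" using sets by auto
    have "S \<times> UNIV \<in> null_sets (A \<Otimes>\<^sub>M B)"
      using S B.emeasure_pair_measure_Times[of S A UNIV] sp sets.top[of B] by auto
    then have "S \<times> UNIV \<in> null_sets \<mu>" using ac by (auto simp: absolutely_continuous_def)
    moreover have "fst -` S \<inter> space \<mu> = S \<times> UNIV" by (auto simp: sp\<mu>)
    ultimately show "S \<in> null_sets (marg1 \<mu>)"
      using S' m by (auto simp: marg1_def null_sets_def emeasure_distr)
  qed
  show "absolutely_continuous B (marg2 \<mu>)"
    unfolding absolutely_continuous_def
  proof
    fix S assume S: "S \<in> null_sets B"
    then have S': "S \<in> sets borel" using sets by auto
    have "UNIV \<times> S \<in> null_sets (A \<Otimes>\<^sub>M B)"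
      using S B.emeasure_pair_measure_Times[of UNIV A S] sp sets.top[of A] by auto
    then have "UNIV \<times> S \<in> null_sets \<mu>" using ac by (auto simp: absolutely_continuous_def)
    moreover have "snd -` S \<inter> space \<mu> = UNIV \<times> S" by (auto simp: sp\<mu>)
    ultimately show "S \<in> null_sets (marg2 \<mu>)"
      using S' m by (auto simp: marg2_def null_sets_def emeasure_distr)
  qed
qed

lemma condition_Wp_absolutely_continuous:
  assumes "condition_Wp \<mu> I1 I2"
  shows "absolutely_continuous lborel (marg1 \<mu>)" "absolutely_continuous lborel (marg2 \<mu>)"
proof -
  obtain q where "q \<in> borel_measurable borel" "\<mu> = density (lborel \<Otimes>\<^sub>M lborel) q"
    using assms by (auto simp: condition_Wp_def lborel_prod)
  then show "absolutely_continuous lborel (marg1 \<mu>)" "absolutely_continuous lborel (marg2 \<mu>)"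
    using absolutely_continuous_marginals[of lborel lborel q \<mu>] sigma_finite_lborel by auto
qed

text \<open>The second factor of the reference measure is Lebesgue, so the second coordinate can be
  corrected. The first marginal may have atoms here, which is why the first coordinate is left in
  place.\<close>

lemma condition_Wad_absolutely_continuous:
  assumes "borel_prob \<mu>" "condition_Wad \<mu> I1 I2"
  shows "absolutely_continuous lborel (marg2 \<mu>)"
proof -
  obtain k where k: "k \<in> borel_measurable borel" "\<mu> = density (marg1 \<mu> \<Otimes>\<^sub>M lborel) (\<lambda>x. ennreal (k x))"
    using assms(2) by (auto simp: condition_Wad_def bounded_disintegration_def)
  interpret prob_space \<mu> using assms(1) by (simp add: borel_prob_def)
  have s: "sets \<mu> = sets (borel \<Otimes>\<^sub>M borel)" using assms(1) unfolding borel_prob_def borel_prod by simp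
  have "fst \<in> borel_measurable \<mu>" unfolding measurable_cong_sets[OF s refl] by simp
  then interpret m: prob_space "marg1 \<mu>" unfolding marg1_def by (rule prob_space_distr)
  have "sigma_finite_measure (marg1 \<mu>)" ..
  moreover have "sets (marg1 \<mu>) = sets borel" by (simp add: marg1_def)
  ultimately show ?thesis
    using absolutely_continuous_marginals(2)[OF _ sigma_finite_lborel _ _ _ k(2)] k(1) by auto
qed

subsection \<open>Couplings\<close>

text \<open>When the first coordinates agree, \<open>g\<close> of the second one is measurable for
  the conditioning \<sigma>-algebra up to a null set. It can be taken out of both conditional
  expectations, which factorises the product.\<close>

lemma causal_of_eq_fst:
  assumes \<pi>: "borel_prob \<pi>" and eq: "AE z in \<pi>. fst (fst z) = fst (snd z)"
  shows "causal \<pi>"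
  unfolding causal_def Let_def
proof (intro ballI impI)
  fix f :: "real \<times> real \<Rightarrow> real" and g :: "real \<Rightarrow> real"
  assume [measurable]: "f \<in> borel_measurable borel" "g \<in> borel_measurable borel"
  assume "bounded (range f)" "bounded (range g)"
  then obtain a b where a: "\<And>x. \<bar>f x\<bar> \<le> a" and b: "\<And>x. \<bar>g x\<bar> \<le> b"
    by (auto simp: bounded_iff)
  interpret prob_space \<pi> using \<pi> by (simp add: borel_prob_def)
  have [measurable_cong]: "sets \<pi> = sets (borel \<Otimes>\<^sub>M borel)" using \<pi> unfolding borel_prob_def borel_prod by simp
  have [measurable]: "(fst :: real \<times> real \<Rightarrow> real) \<in> borel_measurable borel" "(snd :: real \<times> real \<Rightarrow> real) \<in> borel_measurable borel"
    unfolding borel_prod[symmetric] by measurable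
  define F where "F = sigma_of \<pi> (\<lambda>z. fst (fst z))"
  have sub: "subalgebra \<pi> F"
    unfolding subalgebra_def F_def sigma_of_def by (auto simp: sets_vimage_algebra2 intro!: measurable_sets)
  interpret finite_measure_subalgebra \<pi> F by unfold_locales (rule sub)
  have X: "(\<lambda>z. fst (fst z)) \<in> borel_measurable F"
    unfolding F_def sigma_of_def by (rule measurable_vimage_algebra1) auto
  have gX: "(\<lambda>z. g (fst (fst z))) \<in> borel_measurable F" by (rule measurable_compose[OF X]) simp
  have i: "integrable \<pi> (\<lambda>z. g (fst (fst z)))" using b by (intro integrable_const_bound[of _ b]) auto
  have ifg: "integrable \<pi> (\<lambda>z. g (fst (fst z)) * f (fst z))"
    using a b by (intro integrable_const_bound[of _ "b * a"]) (auto simp: abs_mult intro!: mult_mono order_trans[OF abs_ge_zero b])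
  have "AE z in \<pi>. real_cond_exp \<pi> F (\<lambda>z. f (fst z) * g (fst (snd z))) z = real_cond_exp \<pi> F (\<lambda>z. g (fst (fst z)) * f (fst z)) z"
    using eq by (intro real_cond_exp_cong) (auto elim!: eventually_mono)
  moreover have "AE z in \<pi>. real_cond_exp \<pi> F (\<lambda>z. g (fst (fst z)) * f (fst z)) z = g (fst (fst z)) * real_cond_exp \<pi> F (\<lambda>z. f (fst z)) z"
    by (rule real_cond_exp_mult[OF gX _ ifg]) simp
  moreover have "AE z in \<pi>. real_cond_exp \<pi> F (\<lambda>z. g (fst (snd z))) z = real_cond_exp \<pi> F (\<lambda>z. g (fst (fst z))) z"
    using eq by (intro real_cond_exp_cong) (auto elim!: eventually_mono)
  moreover have "AE z in \<pi>. real_cond_exp \<pi> F (\<lambda>z. g (fst (fst z))) z = g (fst (fst z))"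
    by (rule real_cond_exp_F_meas[OF i gX])
  ultimately show "AE z in \<pi>. real_cond_exp \<pi> (sigma_of \<pi> (\<lambda>z. fst (fst z))) (\<lambda>z. f (fst z) * g (fst (snd z))) z =
      real_cond_exp \<pi> (sigma_of \<pi> (\<lambda>z. fst (fst z))) (\<lambda>z. f (fst z)) z *
      real_cond_exp \<pi> (sigma_of \<pi> (\<lambda>z. fst (fst z))) (\<lambda>z. g (fst (snd z))) z"
    unfolding F_def[symmetric] by eventually_elim simp
qed

lemma bicausal_of_eq_fst:
  assumes \<pi>: "borel_prob \<pi>" and eq: "AE z in \<pi>. fst (fst z) = fst (snd z)"
  shows "bicausal \<pi>"
  unfolding bicausal_def
proof
  interpret prob_space \<pi> using \<pi> by (simp add: borel_prob_def)
  have [measurable_cong]: "sets \<pi> = sets (borel \<Otimes>\<^sub>M borel)" using \<pi> unfolding borel_prob_def borel_prod by simp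
  have [measurable]: "(fst :: real \<times> real \<Rightarrow> real) \<in> borel_measurable borel"
    unfolding borel_prod[symmetric] by measurable
  have sw: "(\<lambda>z. (snd z, fst z)) \<in> measurable \<pi> borel" by (intro borel_measurable_Pair) measurable
  show "causal \<pi>" by (rule causal_of_eq_fst[OF assms])
  show "causal (distr \<pi> borel (\<lambda>z. (snd z, fst z)))"
  proof (rule causal_of_eq_fst)
    show "borel_prob (distr \<pi> borel (\<lambda>z. (snd z, fst z)))"
      using prob_space_distr[OF sw] by (simp add: borel_prob_def)
    have "{z. fst (fst z) = fst (snd z)} \<in> sets (borel :: ((real \<times> real) \<times> (real \<times> real)) measure)"
      by (intro borel_closed closed_Collect_eq continuous_intros)
    then show "AE z in distr \<pi> borel (\<lambda>z. (snd z, fst z)). fst (fst z) = fst (snd z)"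
      using eq sw by (subst AE_distr_iff) (auto elim!: eventually_mono)
  qed
qed

lemma (in prob_space) plan_in_couplings:
  fixes P :: "'a \<Rightarrow> 'b::second_countable_topology" and V :: "'a \<Rightarrow> 'c::second_countable_topology"
  assumes [measurable]: "random_variable borel P" "random_variable borel V"
  shows "distr M borel (\<lambda>\<omega>. (P \<omega>, V \<omega>)) \<in> couplings (distr M borel P) (distr M borel V)"
proof -
  have [measurable]: "random_variable borel (\<lambda>\<omega>. (P \<omega>, V \<omega>))" by (rule borel_measurable_Pair) fact+
  have [measurable]: "fst \<in> borel_measurable (borel :: ('b \<times> 'c) measure)" "snd \<in> borel_measurable (borel :: ('b \<times> 'c) measure)"
    by (simp_all add: borel_prod[symmetric])
  show ?thesis
    unfolding couplings_def borel_prob_def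
    by (auto simp: distr_distr comp_def intro!: prob_space_distr)
qed

text \<open>A single competitor bounds both infima: the law of \<open>(V1, V2)\<close> is the target
  measure, and the joint law with \<open>P\<close> is the plan. In the adapted case, equality of the
  first coordinates makes that plan admissible.\<close>

lemma (in prob_space) dist_to_couplings_le:
  fixes P :: "'a \<Rightarrow> real \<times> real" and V1 V2 :: "'a \<Rightarrow> real"
  assumes [measurable]: "random_variable borel P" "random_variable borel V1" "random_variable borel V2"
    and d: "d = Wp p \<or> d = Wad p \<and> (\<forall>\<omega>\<in>space M. fst (P \<omega>) = V1 \<omega>)"
  shows "dist_to_set d (distr M borel P) (couplings (distr M borel V1) (distr M borel V2))
    \<le> ennreal_powr (\<integral>\<^sup>+\<omega>. ennreal (norm (P \<omega> - (V1 \<omega>, V2 \<omega>)) powr p) \<partial>M) (1 / p)"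
proof -
  define V where "V \<omega> = (V1 \<omega>, V2 \<omega>)" for \<omega>
  have V[measurable]: "random_variable borel V" unfolding V_def[abs_def] by (rule borel_measurable_Pair) fact+
  define \<pi> where "\<pi> = distr M borel (\<lambda>\<omega>. (P \<omega>, V \<omega>))"
  have PV[measurable]: "random_variable borel (\<lambda>\<omega>. (P \<omega>, V \<omega>))" by (rule borel_measurable_Pair) fact+
  have \<pi>: "\<pi> \<in> couplings (distr M borel P) (distr M borel V)"
    unfolding \<pi>_def by (rule plan_in_couplings) fact+
  have \<nu>: "distr M borel V \<in> couplings (distr M borel V1) (distr M borel V2)"
    unfolding V_def[abs_def] by (rule plan_in_couplings) fact+
  have "(\<lambda>z :: (real \<times> real) \<times> (real \<times> real). norm (fst z - snd z)) \<in> borel_measurable borel"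
    by (intro borel_measurable_continuous_onI continuous_intros)
  then have "(\<lambda>z :: (real \<times> real) \<times> (real \<times> real). ennreal (norm (fst z - snd z) powr p)) \<in> borel_measurable borel"
    by measurable
  then have cost: "(\<integral>\<^sup>+z. ennreal (norm (fst z - snd z) powr p) \<partial>\<pi>) = (\<integral>\<^sup>+\<omega>. ennreal (norm (P \<omega> - V \<omega>) powr p) \<partial>M)"
    unfolding \<pi>_def by (subst nn_integral_distr) auto
  have "d (distr M borel P) (distr M borel V)
      \<le> ennreal_powr (\<integral>\<^sup>+z. ennreal (norm (fst z - snd z) powr p) \<partial>\<pi>) (1 / p)"
    using d
  proof (elim disjE conjE)
    assume "d = Wp p"
    then show ?thesis by (auto simp: Wp_def transport_dist_def intro!: INF_lower \<pi>)
  next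
    assume "d = Wad p" and eq: "\<forall>\<omega>\<in>space M. fst (P \<omega>) = V1 \<omega>"
    have "{z. fst (fst z) = fst (snd z)} \<in> sets (borel :: ((real \<times> real) \<times> (real \<times> real)) measure)"
      by (intro borel_closed closed_Collect_eq continuous_intros)
    then have "AE z in \<pi>. fst (fst z) = fst (snd z)"
      unfolding \<pi>_def using eq by (subst AE_distr_iff) (auto simp: V_def)
    then have "bicausal \<pi>" using \<pi> by (intro bicausal_of_eq_fst) (auto simp: couplings_def)
    then show ?thesis
      using \<open>d = Wad p\<close> \<pi> by (auto simp: Wad_def transport_dist_def intro!: INF_lower)
  qed
  then show ?thesis
    unfolding dist_to_set_def cost V_def by (rule INF_lower2[OF \<nu>[unfolded V_def]])
qed

lemma bounded_of_compact_fun_supp: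
  fixes T :: "'a::topological_space \<Rightarrow> 'b::real_normed_vector"
  assumes "continuous_on UNIV T" "compact (fun_supp T)"
  obtains K where "\<And>x. norm (T x) \<le> K"
proof -
  have "bounded (T ` fun_supp T)"
    using assms by (intro compact_imp_bounded compact_continuous_image) (auto intro: continuous_on_subset)
  then obtain K where K: "0 < K" "\<And>x. x \<in> fun_supp T \<Longrightarrow> norm (T x) \<le> K"
    by (auto simp: bounded_pos)
  have "norm (T x) \<le> K" for x
  proof (cases "T x = 0")
    case False
    then have "x \<in> fun_supp T" using closure_subset[of "{x. T x \<noteq> 0}"] by (auto simp: fun_supp_def)
    then show ?thesis by (rule K)
  qed (use K in simp)
  then show ?thesis by (rule that)
qed

theorem proposition3p6:
  fixes p :: real
    and \<mu> :: "(real \<times> real) measure"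
    and d :: "(real \<times> real) measure \<Rightarrow> (real \<times> real) measure \<Rightarrow> ennreal"
    and \<Theta> :: "real \<times> real \<Rightarrow> real \<times> real"
    and I1 I2 M1 M2 :: "real set"
  assumes "p > 1"
    and "\<mu> \<in> prob_moment p"
    and "(d = Wp p \<and> condition_Wp \<mu> I1 I2) \<or>
         (d = Wad p \<and> condition_Wad \<mu> I1 I2 \<and> (\<forall>x. fst (\<Theta> x) = 0))"
    and "C2 \<Theta>" and "compact (fun_supp \<Theta>)"
    and "fun_supp \<Theta> \<subseteq> M1 \<times> M2" and "M1 \<subset> I1" and "M2 \<subset> I2"
  shows "\<exists>C::real. C > 0 \<and>
    Limsup (at_right 0) (\<lambda>r::real. ennreal (1 / r) *
        dist_to_set d (perturb \<mu> (\<lambda>x. r *\<^sub>R \<Theta> x)) (couplings (marg1 \<mu>) (marg2 \<mu>)))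
    \<le> ennreal C *
        (lp_norm p (marg1 \<mu>) (cond_exp_given \<mu> fst (\<lambda>x. fst (\<Theta> x))) +
         lp_norm p (marg2 \<mu>) (cond_exp_given \<mu> snd (\<lambda>x. snd (\<Theta> x))))"
proof -
  note p = assms(1)
  have \<mu>: "borel_prob \<mu>" using assms(2) by (simp add: prob_moment_def)
  then interpret M: prob_space \<mu> by (simp add: borel_prob_def)
  interpret U: prob_space unit_uniform by (rule prob_space_unit_uniform)
  interpret MU: pair_prob_space \<mu> unit_uniform ..
  let ?N = "\<mu> \<Otimes>\<^sub>M unit_uniform"
  have s: "sets \<mu> = sets borel" using \<mu> by (simp add: borel_prob_def)
  obtain \<Theta>' where "\<And>x. (\<Theta> has_derivative blinfun_apply (\<Theta>' x)) (at x)"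
    using assms(4) unfolding C2_def by blast
  then have cont: "continuous_on UNIV \<Theta>"
    by (meson continuous_at_imp_continuous_on has_derivative_continuous)
  have \<Theta>[measurable]: "\<Theta> \<in> borel_measurable borel" using cont by (rule borel_measurable_continuous_onI)
  obtain K where K: "\<And>x. norm (\<Theta> x) \<le> K" using bounded_of_compact_fun_supp[OF cont assms(5)] by blast
  have K0: "0 \<le> K" using norm_ge_zero[of "\<Theta> 0"] K[of 0] by linarith
  have fs[measurable]: "(fst :: real \<times> real \<Rightarrow> real) \<in> borel_measurable borel"
      "(snd :: real \<times> real \<Rightarrow> real) \<in> borel_measurable borel"
    by (simp_all add: borel_prod[symmetric])
  have f12: "(\<lambda>x. fst (\<Theta> x)) \<in> borel_measurable borel" "(\<lambda>x. snd (\<Theta> x)) \<in> borel_measurable borel"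
    by (rule measurable_compose[OF \<Theta>], simp)+
  have K12: "\<bar>fst (\<Theta> x)\<bar> \<le> K" "\<bar>snd (\<Theta> x)\<bar> \<le> K" for x
    using K[of x] norm_fst_le[of "fst (\<Theta> x)" "snd (\<Theta> x)"] norm_snd_le[of "snd (\<Theta> x)" "fst (\<Theta> x)"] by auto
  define P where "P r \<omega> = (fst (fst \<omega>) + r * fst (\<Theta> (fst \<omega>)), snd (fst \<omega>) + r * snd (\<Theta> (fst \<omega>)))"
    for r :: real and \<omega> :: "(real \<times> real) \<times> real"
  have P_eq: "P r \<omega> = fst \<omega> + r *\<^sub>R \<Theta> (fst \<omega>)" for r \<omega> by (simp add: P_def prod_eq_iff)
  have fN: "fst \<in> measurable ?N \<mu>" by simp
  then have fNb: "fst \<in> borel_measurable ?N" using measurable_cong_sets[OF refl s] by blast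
  have P: "P r \<in> borel_measurable ?N" for r
    unfolding P_eq[abs_def] using measurable_compose[OF fNb \<Theta>] fNb by (intro borel_measurable_add borel_measurable_scaleR) auto
  have law: "distr ?N \<mu> fst = \<mu>" by (rule U.distr_pair_fst)
  have perturb: "perturb \<mu> (\<lambda>x. r *\<^sub>R \<Theta> x) = distr ?N borel (P r)" for r
  proof -
    have m: "(\<lambda>x. x + r *\<^sub>R \<Theta> x) \<in> measurable \<mu> borel"
      using \<Theta> s by (intro borel_measurable_add borel_measurable_scaleR) (auto cong: measurable_cong_sets)
    show ?thesis unfolding perturb_def
      by (subst law[symmetric], subst distr_distr[OF m fN]) (simp add: P_eq[abs_def] comp_def)
  qed
  have ac2: "absolutely_continuous lborel (distr \<mu> borel snd)"
    using assms(3) condition_Wp_absolutely_continuous(2) condition_Wad_absolutely_continuous[OF \<mu>]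
    unfolding marg2_def by blast
  obtain h2 V2 E2 where 2:
    "h2 \<in> borel_measurable borel" "\<forall>t. \<bar>h2 t\<bar> \<le> K"
    "lp_norm p ?N (\<lambda>\<omega>. h2 (snd (fst \<omega>))) = lp_norm p (distr \<mu> borel snd) (cond_exp_given \<mu> snd (\<lambda>x. snd (\<Theta> x)))"
    "correction ?N (2 * K + 2) (\<lambda>\<omega>. snd (fst \<omega>)) (\<lambda>\<omega>. snd (\<Theta> (fst \<omega>))) (\<lambda>\<omega>. h2 (snd (fst \<omega>))) V2 E2"
    by (rule coordinate_correction[OF \<mu> disjI2[OF refl] f12(2) K12(2) ac2, where p=p], rule that)
  have a2: "(\<lambda>\<omega>. h2 (snd (fst \<omega>))) \<in> borel_measurable ?N"
    by (intro measurable_compose[OF _ 2(1)] measurable_compose[OF fNb fs(2)])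
  define D where "D r = dist_to_set d (perturb \<mu> (\<lambda>x. r *\<^sub>R \<Theta> x)) (couplings (marg1 \<mu>) (marg2 \<mu>))" for r
  have Xlaw: "distr ?N borel (\<lambda>\<omega>. Y (fst \<omega>)) = distr \<mu> borel Y" if "Y \<in> borel_measurable borel" for Y :: "real \<times> real \<Rightarrow> real"
  proof -
    have "Y \<in> borel_measurable \<mu>" using that measurable_cong_sets[OF s refl] by blast
    then show ?thesis by (subst (2) law[symmetric], subst distr_distr[OF _ fN]) (simp_all add: comp_def)
  qed
  \<comment> \<open>The first correction is kept abstract, so that it can be either the rearranged
    coordinate or the untouched one.\<close>
  have D: "D r \<le> ennreal_powr (\<integral>\<^sup>+\<omega>. ennreal (norm (P r \<omega> - (V1 r \<omega>, V2 r \<omega>)) powr p) \<partial>?N) (1 / p)"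
    if r: "0 < r" and c: "correction ?N (2 * K + 2) (\<lambda>\<omega>. fst (fst \<omega>)) Z a V1 E1"
      and d: "d = Wp p \<or> d = Wad p \<and> (\<forall>\<omega>\<in>space ?N. fst (P r \<omega>) = V1 r \<omega>)" for r V1 Z a E1
  proof -
    have V: "V1 r \<in> borel_measurable ?N" "distr ?N borel (V1 r) = marg1 \<mu>"
        "V2 r \<in> borel_measurable ?N" "distr ?N borel (V2 r) = marg2 \<mu>"
      using c 2(4) r by (simp_all add: correction_def marg1_def marg2_def Xlaw fs)
    show ?thesis using MU.dist_to_couplings_le[OF P V(1,3) d] by (simp add: D_def perturb V)
  qed
  have K2: "0 \<le> 2 * K + 2" "\<bar>h2 t\<bar> \<le> 2 * K + 2" for t
    using 2(2)[rule_format, of t] K0 by linarith+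
  have "Limsup (at_right 0) (\<lambda>r. ennreal (1 / r) * D r) \<le> ennreal 4 *
        (lp_norm p (marg1 \<mu>) (cond_exp_given \<mu> fst (\<lambda>x. fst (\<Theta> x))) +
         lp_norm p (marg2 \<mu>) (cond_exp_given \<mu> snd (\<lambda>x. snd (\<Theta> x))))"
    using assms(3)
  proof (elim disjE conjE)
    assume d: "d = Wp p" and "condition_Wp \<mu> I1 I2"
    then have ac1: "absolutely_continuous lborel (distr \<mu> borel fst)"
      using condition_Wp_absolutely_continuous(1) unfolding marg1_def by blast
    obtain h1 V1 E1 where 1:
      "h1 \<in> borel_measurable borel" "\<forall>t. \<bar>h1 t\<bar> \<le> K"
      "lp_norm p ?N (\<lambda>\<omega>. h1 (fst (fst \<omega>))) = lp_norm p (distr \<mu> borel fst) (cond_exp_given \<mu> fst (\<lambda>x. fst (\<Theta> x)))"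
      "correction ?N (2 * K + 2) (\<lambda>\<omega>. fst (fst \<omega>)) (\<lambda>\<omega>. fst (\<Theta> (fst \<omega>))) (\<lambda>\<omega>. h1 (fst (fst \<omega>))) V1 E1"
      by (rule coordinate_correction[OF \<mu> disjI1[OF refl] f12(1) K12(1) ac1, where p=p], rule that)
    have a1: "(\<lambda>\<omega>. h1 (fst (fst \<omega>))) \<in> borel_measurable ?N"
      by (intro measurable_compose[OF _ 1(1)] measurable_compose[OF fNb fs(1)])
    have "Limsup (at_right 0) (\<lambda>r. ennreal (1 / r) * D r) \<le> ennreal 4 *
        (lp_norm p ?N (\<lambda>\<omega>. h1 (fst (fst \<omega>))) + lp_norm p ?N (\<lambda>\<omega>. h2 (snd (fst \<omega>))))"
    proof (rule MU.Limsup_transport_cost_le[OF p K2(1) 1(4) 2(4) a1 a2 _ K2(2)])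
      show "\<bar>h1 t\<bar> \<le> 2 * K + 2" for t using 1(2)[rule_format, of t] K0 by linarith
    qed (use D[OF _ 1(4)] d in \<open>simp add: P_def\<close>)
    then show ?thesis by (simp add: 1(3) 2(3) marg1_def marg2_def)
  next
    assume d: "d = Wad p" and \<Theta>1: "\<forall>x. fst (\<Theta> x) = 0"
    have X1: "(\<lambda>\<omega>. fst (fst \<omega>)) \<in> borel_measurable ?N" by (rule measurable_compose[OF fNb fs(1)])
    \<comment> \<open>The trivial correction: as \<open>\<Theta>\<close> does not move the first
      coordinate, its law is already right, and there is neither displacement nor error.\<close>
    have 1: "correction ?N (2 * K + 2) (\<lambda>\<omega>. fst (fst \<omega>)) (\<lambda>\<omega>. fst (\<Theta> (fst \<omega>))) (\<lambda>\<omega>. 0) (\<lambda>r \<omega>. fst (fst \<omega>)) (\<lambda>r \<omega>. 0)"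
      using X1 K0 by (simp add: correction_def \<Theta>1[rule_format])
    have "Limsup (at_right 0) (\<lambda>r. ennreal (1 / r) * D r) \<le> ennreal 4 *
        (lp_norm p ?N (\<lambda>\<omega>. 0) + lp_norm p ?N (\<lambda>\<omega>. h2 (snd (fst \<omega>))))"
      by (rule MU.Limsup_transport_cost_le[OF p K2(1) 1 2(4) _ a2 _ K2(2)])
        (use D[OF _ 1] K2(1) d in \<open>simp_all add: P_def \<Theta>1[rule_format]\<close>)
    also have "lp_norm p ?N (\<lambda>\<omega>. 0) = 0" using p by (simp add: lp_norm_def ennreal_powr_def)
    also have "0 + lp_norm p ?N (\<lambda>\<omega>. h2 (snd (fst \<omega>))) \<le>
        lp_norm p (marg1 \<mu>) (cond_exp_given \<mu> fst (\<lambda>x. fst (\<Theta> x))) +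
        lp_norm p (marg2 \<mu>) (cond_exp_given \<mu> snd (\<lambda>x. snd (\<Theta> x)))"
      unfolding 2(3) marg2_def by (intro add_right_mono zero_le)
    finally show ?thesis by (simp only: mult_left_mono zero_le)
  qed
  \<comment> \<open>The witness 4 depends neither on \<open>p\<close> nor on \<open>\<mu>\<close> or
    \<open>\<Theta>\<close>; the bound \<open>K\<close> enters only the error terms, which vanish in
    the limit.\<close>
  then show ?thesis unfolding D_def by (intro exI[of _ 4] conjI zero_less_numeral)
qed

end
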